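(* Let $T$ be a triangulation of the convex $(n+2)$-gon and let $M_T$ be the corresponding plane perfect matching on $v_1,\dots,v_{2n}$. Every diagonal-flip of $T$ corresponds to either a merge or a split of one of the arcs of $M_T$ whose starting vertex has index greater than one: if $T'$ is obtained from $T$ by flipping one diagonal, then $M_{T'}$ is obtained from $M_T$ by a merge for $\alpha$ or a split of $\alpha$, for some arc $\alpha$ of $M_T$ whose starting vertex $v_p$ satisfies $p>1$. The reverse also holds: if a matching $M'$ is obtained from a plane perfect matching $M$ on $v_1,\dots,v_{2n}$ by a merge for, or a split of, an arc whose starting vertex has index greater than one, then the triangulation $T_{M'}$ is obtained from $T_M$ by a diagonal-flip.
   Context: Let $n\ge 1$. Matchings: plane (non-crossing) perfect matchings on vertices $v_1,\dots,v_{2n}$ in convex position, labeled in clockwise order. Each edge $v_iv_j$ with $i<j$ is directed from $v_i$ to $v_j$ (so $v_i$ is its starting vertex and $v_j$ its ending vertex). The outdegree sequence of a matching $M$ is $B(M)=(b_1,\dots,b_{2n})\in\{0,1\}^{2n}$, where $b_i$ is the outdegree of $v_i$; it determines $M$. Triangulations: triangulations of a convex $(n+2)$-gon with points $p_1,\dots,p_{n+2}$ labeled in clockwise order. Edges $p_ip_j$ with $i<j$ are directed from $p_i$ to $p_j$. The outdegree sequence of $T$ is $D(T)=(d_1,\dots,d_n)$, where $d_i$ is the outdegree of $p_i$, counting all diagonals of $T$ and the boundary edge $p_1p_{n+2}$, but no other boundary edge; it determines $T$. Bijection: $M$ and $T$ correspond to each other (written $T=T_M$, $M=M_T$) if $d_1$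 is the number of 1s before the first 0 in $B(M)$ and, for $2\le i\le n$, $d_i$ is the number of 1s between the $(i-1)$-st 0 and the $i$-th 0 in $B(M)$. This is a bijection between the plane perfect matchings and the triangulations. Diagonal-flip: if $T$ contains the quadrilateral $p_ip_jp_kp_l$ ($i<j<k<l$) as a subgraph, a diagonal-flip exchanges the diagonal of $T$ inside this quadrilateral with the other diagonal of the quadrilateral. Single row presentation: draw $v_1,\dots,v_{2n}$ in one row from left to right, with the matching edges drawn without crossings below as arcs. The section of an arc $v_pv_q$ ($p<q$) is the block of positions $p,p+1,\dots,q$ together with all arcs on these vertices (equivalently, the part of $B(M)$ that starts with the 1 at position $p$ and ends when the numbers of 1s and 0s coincide for the first time). Merge: let $\alpha=v_pv_q$ ($p<q$, $p>2$) be an arc such that $v_{p-1}$ is the ending vertex of an arc $\beta=v_iv_{p-1}$, and let $\mathcal A$ be the section of $\beta$. The merge for $\alpha$ moves the whole section $\mathcal A$ one position to the right, so that it occupies positions $i+1,\dots,p$, and replaces $\alpha$ by $v_iv_q$; all other arcs are unchanged. Split: let $\alpha=v_pv_q$ ($p<q$, $p>1$) be an arc such that $v_{p-1}$ is the starting vertex of an arc $\beta=v_{p-1}v_r$ (then $r>q$). The split of $\alpha$ (from the section of $\beta$) moves the whole section of $\alpha$ one position to the left, so that it occupies positions $p-1,\dots,q-1$, and replaces $\beta$ by $v_qv_r$; all other arcs are unchanged. Split and merge are inverse operations. *)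

theory Defs
  imports Main
begin

text \<open>
  Points in convex position are represented by their labels \<open>1, \<dots>, m\<close> in clockwise order, and
  the edge between the points \<open>i < j\<close>, directed from \<open>i\<close> to \<open>j\<close>, by the pair \<open>(i, j)\<close>. Since
  the points are in convex position, two edges cross iff their four endpoints are distinct and
  alternate in the cyclic order.
\<close>

type_synonym edge = "nat \<times> nat"

definition edges :: "nat \<Rightarrow> edge set" where
  "edges m = {(i, j). 1 \<le> i \<and> i < j \<and> j \<le> m}"

definition crossing :: "edge \<Rightarrow> edge \<Rightarrow> bool" where
  "crossing e f \<longleftrightarrow>
     (fst e < fst f \<and> fst f < snd e \<and> snd e < snd f) \<or>
     (fst f < fst e \<and> fst e < snd f \<and> snd f < snd e)"

definition plane :: "edge set \<Rightarrow> bool" where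
  "plane E \<longleftrightarrow> (\<forall>e\<in>E. \<forall>f\<in>E. \<not> crossing e f)"

definition plane_perfect_matching :: "nat \<Rightarrow> edge set \<Rightarrow> bool" where
  "plane_perfect_matching n M \<longleftrightarrow>
     M \<subseteq> edges (2 * n) \<and> plane M \<and>
     (\<forall>v\<in>{1..2 * n}. \<exists>!e. e \<in> M \<and> (v = fst e \<or> v = snd e))"

definition matching_outdegree :: "edge set \<Rightarrow> nat \<Rightarrow> nat" where
  "matching_outdegree M i = card {e \<in> M. fst e = i}"

text \<open>
  A triangulation of the convex \<open>m\<close>-gon is a maximal plane graph on its vertices; by maximality
  it contains all boundary edges.
\<close>

definition triangulation :: "nat \<Rightarrow> edge set \<Rightarrow> bool" where
  "triangulation m T \<longleftrightarrow>
     T \<subseteq> edges m \<and> plane T \<and>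
     (\<forall>e \<in> edges m. plane (insert e T) \<longrightarrow> e \<in> T)"

definition boundary_edges :: "nat \<Rightarrow> edge set" where
  "boundary_edges m = insert (1, m) {(i, i + 1) | i. 1 \<le> i \<and> i < m}"

definition triangulation_outdegree :: "nat \<Rightarrow> edge set \<Rightarrow> nat \<Rightarrow> nat" where
  "triangulation_outdegree m T i =
     card {e \<in> T. fst e = i \<and> (e \<notin> boundary_edges m \<or> e = (1, m))}"

text \<open>
  \<open>zero_pos b k\<close> is the position of the \<open>k\<close>-th zero of the sequence \<open>b 1, b 2, \<dots>\<close>, with the
  convention that the \<open>0\<close>-th zero is at position \<open>0\<close>. The outdegree sequence of a plane perfect
  matching on \<open>2 * n\<close> vertices has exactly \<open>n\<close> zeros among its first \<open>2 * n\<close> entries, so for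
  \<open>k \<le> n\<close> the values outside \<open>{1..2 * n}\<close> do not matter.
\<close>

primrec zero_pos :: "(nat \<Rightarrow> nat) \<Rightarrow> nat \<Rightarrow> nat" where
  "zero_pos b 0 = 0"
| "zero_pos b (Suc k) = (LEAST j. zero_pos b k < j \<and> b j = 0)"

definition corresponds :: "nat \<Rightarrow> edge set \<Rightarrow> edge set \<Rightarrow> bool" where
  "corresponds n M T \<longleftrightarrow>
     (\<forall>i\<in>{1..n}. triangulation_outdegree (n + 2) T i =
        card {j. zero_pos (matching_outdegree M) (i - 1) < j \<and>
                 j < zero_pos (matching_outdegree M) i \<and> matching_outdegree M j = 1})"

definition matching_of :: "nat \<Rightarrow> edge set \<Rightarrow> edge set" where
  "matching_of n T = (THE M. plane_perfect_matching n M \<and> corresponds n M T)"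

definition triangulation_of :: "nat \<Rightarrow> edge set \<Rightarrow> edge set" where
  "triangulation_of n M = (THE T. triangulation (n + 2) T \<and> corresponds n M T)"

definition diagonal_flip :: "edge set \<Rightarrow> edge set \<Rightarrow> bool" where
  "diagonal_flip T T' \<longleftrightarrow>
     (\<exists>i j k l. i < j \<and> j < k \<and> k < l \<and>
        {(i, j), (j, k), (k, l), (i, l)} \<subseteq> T \<and>
        ((i, k) \<in> T \<and> T' = insert (j, l) (T - {(i, k)}) \<or>
         (j, l) \<in> T \<and> T' = insert (i, k) (T - {(j, l)})))"

definition section_arcs :: "edge set \<Rightarrow> edge \<Rightarrow> edge set" where
  "section_arcs M \<alpha> =
     {e \<in> M. fst e \<in> {fst \<alpha>..snd \<alpha>} \<and> snd e \<in> {fst \<alpha>..snd \<alpha>}}"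

text \<open>
  In the following two definitions the section that is moved includes the arc that defines it.
\<close>

definition merge_for :: "edge set \<Rightarrow> edge \<Rightarrow> edge set \<Rightarrow> bool" where
  "merge_for M \<alpha> M' \<longleftrightarrow>
     (\<exists>p q i. \<alpha> = (p, q) \<and> (p, q) \<in> M \<and> p > 2 \<and> (i, p - 1) \<in> M \<and>
        M' = (M - section_arcs M (i, p - 1) - {(p, q)})
             \<union> (\<lambda>(a, b). (a + 1, b + 1)) ` section_arcs M (i, p - 1)
             \<union> {(i, q)})"

definition split_of :: "edge set \<Rightarrow> edge \<Rightarrow> edge set \<Rightarrow> bool" where
  "split_of M \<alpha> M' \<longleftrightarrow>
     (\<exists>p q r. \<alpha> = (p, q) \<and> (p, q) \<in> M \<and> p > 1 \<and> (p - 1, r) \<in> M \<and>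
        M' = (M - section_arcs M (p, q) - {(p - 1, r)})
             \<union> (\<lambda>(a, b). (a - 1, b - 1)) ` section_arcs M (p, q)
             \<union> {(q, r)})"

end

theory Submission
  imports Defs
begin

text \<open>
  Both families are indexed by binary trees: the triangle on the edge \<open>(i, j)\<close> with apex \<open>k\<close>
  splits a triangulated polygon into polygons on \<open>i, \<dots>, k\<close> and \<open>k, \<dots>, j\<close>, and the first arc
  splits a matching into the part below the arc and the part to its right. If \<open>t\<close> has the
  subtrees \<open>l\<close> and \<open>r\<close>, the outdegree word of its matching is \<open>W(t) = 1 W(l) 0 W(r)\<close>, and
  the outdegrees of its triangulation are the lengths of the runs of ones in the same word; hence
  a matching and a triangulation correspond iff they have the same tree. Flips as well as merges and
  splits are exactly the tree rotations: on words, \<open>1 1 A 0 B 0 C\<close> becomes \<open>1 A 0 1 B 0 C\<close>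
  by a split and conversely by a merge, while the subtrees \<open>A\<close>, \<open>B\<close>, \<open>C\<close> are the polygons
  beyond three sides of the quadrilateral whose diagonal is flipped.
\<close>

subsection \<open>Rotations of binary trees\<close>

datatype btree = Leaf | Node btree btree

primrec nodes :: "btree \<Rightarrow> nat" where
  "nodes Leaf = 0"
| "nodes (Node l r) = Suc (nodes l + nodes r)"

text \<open>A leaf is the degenerate polygon with one edge, so leaves become sides. A tree with
  \<open>m\<close> nodes occupies the \<open>m + 2\<close> labels from \<open>i\<close> to
  \<open>i + m + 1\<close>; the two subtrees share the apex \<open>i + nodes l + 1\<close>.\<close>

primrec tri :: "btree \<Rightarrow> nat \<Rightarrow> edge set" where
  "tri Leaf i = {(i, Suc i)}"
| "tri (Node l r) i =
     insert (i, i + nodes l + nodes r + 2) (tri l i \<union> tri r (i + nodes l + 1))"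

text \<open>A tree with \<open>m\<close> nodes fills the \<open>2 * m\<close> positions from
  \<open>k\<close> on; unlike in \<open>tri\<close>, the two subtrees share no position.\<close>

primrec mat :: "btree \<Rightarrow> nat \<Rightarrow> edge set" where
  "mat Leaf k = {}"
| "mat (Node l r) k =
     insert (k, k + 2 * nodes l + 1) (mat l (k + 1) \<union> mat r (k + 2 * nodes l + 2))"

text \<open>Only one direction of rotation is generated: it corresponds to a split, and read
  backwards to a merge.\<close>

inductive rot :: "btree \<Rightarrow> btree \<Rightarrow> bool" where
  root: "rot (Node (Node a b) c) (Node a (Node b c))"
| left: "rot l l' \<Longrightarrow> rot (Node l r) (Node l' r)"
| right: "rot r r' \<Longrightarrow> rot (Node l r) (Node l r')"

lemma rot_nodes: "rot t t' \<Longrightarrow> nodes t' = nodes t"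
  by (induction rule: rot.induct) auto

subsection \<open>Triangulations as binary trees\<close>

text \<open>Arbitrary end labels permit recursion into subpolygons. Maximality speaks of crossings
  with \<open>T\<close> alone, which passes to the parts more easily than planarity of an enlarged
  set.\<close>

definition triang_on :: "nat \<Rightarrow> nat \<Rightarrow> edge set \<Rightarrow> bool" where
  "triang_on i j T \<longleftrightarrow>
     (\<forall>(a, b)\<in>T. i \<le> a \<and> a < b \<and> b \<le> j) \<and> plane T \<and>
     (\<forall>a b. i \<le> a \<and> a < b \<and> b \<le> j \<and>
        (\<forall>c d. (c, d) \<in> T \<longrightarrow> \<not> crossing (a, b) (c, d)) \<longrightarrow> (a, b) \<in> T)"

lemma crossing_commute: "crossing e f \<longleftrightarrow> crossing f e"
  by (auto simp: crossing_def)

lemma not_crossing_self: "\<not> crossing e e"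
  by (auto simp: crossing_def)

lemma plane_insert:
  "plane (insert e T) \<longleftrightarrow>
     plane T \<and> (\<forall>c d. (c, d) \<in> T \<longrightarrow> \<not> crossing e (c, d))"
proof -
  have "plane (insert e T) \<longleftrightarrow> plane T \<and> (\<forall>f\<in>T. \<not> crossing e f)"
    using not_crossing_self crossing_commute unfolding plane_def by blast
  then show ?thesis by auto
qed

lemma planeD: "plane T \<Longrightarrow> (a, b) \<in> T \<Longrightarrow> (c, d) \<in> T \<Longrightarrow> a < c \<Longrightarrow> c < b \<Longrightarrow> b < d \<Longrightarrow> False"
  unfolding plane_def crossing_def by fastforce

lemma triangulation_iff: "triangulation m T \<longleftrightarrow> triang_on 1 m T"
proof -
  have "(\<forall>e\<in>edges m. plane (insert e T) \<longrightarrow> e \<in> T) \<longleftrightarrow>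
      (\<forall>a b. 1 \<le> a \<and> a < b \<and> b \<le> m \<and>
        (\<forall>c d. (c, d) \<in> T \<longrightarrow> \<not> crossing (a, b) (c, d)) \<longrightarrow> (a, b) \<in> T)"
    if "plane T"
    using that unfolding plane_insert edges_def by auto
  then show ?thesis
    unfolding triangulation_def triang_on_def by (auto simp: edges_def)
qed

lemma tri_range: "(a, b) \<in> tri t i \<Longrightarrow> i \<le> a \<and> a < b \<and> b \<le> i + nodes t + 1"
  by (induction t arbitrary: i) fastforce+

lemma tri_top: "(i, i + nodes t + 1) \<in> tri t i"
  by (cases t) auto

lemma tri_plane: "plane (tri t i)"
proof (induction t arbitrary: i)
  case Leaf
  then show ?case by (auto simp: plane_def crossing_def)
next
  case (Node l r)
  have "\<not> crossing e f" if "e \<in> tri l i" "f \<in> tri r (i + nodes l + 1)" for e f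
    using that tri_range[of "fst e" "snd e" l i] tri_range[of "fst f" "snd f" r "i + nodes l + 1"]
    by (auto simp: crossing_def)
  then have "plane (tri l i \<union> tri r (i + nodes l + 1))"
    using Node crossing_commute unfolding plane_def by blast
  moreover have "\<not> crossing (i, i + nodes l + nodes r + 2) f"
    if "f \<in> tri l i \<union> tri r (i + nodes l + 1)" for f
    using that tri_range[of "fst f" "snd f" l i] tri_range[of "fst f" "snd f" r "i + nodes l + 1"]
    by (auto simp: crossing_def)
  ultimately show ?case by (simp add: plane_insert)
qed

text \<open>Planarity comes from the label ranges, maximality by induction: a chord on one side of
  the apex belongs to that subtree, and a chord passing over the apex must start at \<open>i\<close>
  and end at the last label, since otherwise it crosses one of the two edges at the apex.\<close>

lemma triang_on_tri: "triang_on i (i + nodes t + 1) (tri t i)"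
proof -
  have "(a, b) \<in> tri t i"
    if "i \<le> a" "a < b" "b \<le> i + nodes t + 1"
      "\<forall>c d. (c, d) \<in> tri t i \<longrightarrow> \<not> crossing (a, b) (c, d)" for a b
    using that
  proof (induction t arbitrary: i)
    case Leaf
    then show ?case by auto
  next
    case (Node l r)
    let ?k = "i + nodes l + 1"
    have l: "\<not> crossing (a, b) (i, ?k)"
      using Node.prems(4) tri_top[of i l] by auto
    have "?k + nodes r + 1 = i + nodes l + nodes r + 2" by simp
    then have r: "\<not> crossing (a, b) (?k, i + nodes l + nodes r + 2)"
      using Node.prems(4) tri_top[of ?k r] by (metis UnCI insertCI tri.simps(2))
    consider "b \<le> ?k" | "?k \<le> a" | "a < ?k" "?k < b" by linarith
    then show ?case
    proof cases
      case 1
      then have "(a, b) \<in> tri l i" using Node.prems by (intro Node.IH(1)) auto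
      then show ?thesis by simp
    next
      case 2
      then have "(a, b) \<in> tri r ?k" using Node.prems by (intro Node.IH(2)) auto
      then show ?thesis by simp
    next
      case 3
      then show ?thesis using l r Node.prems(1-3) by (auto simp: crossing_def)
    qed
  qed
  then show ?thesis
    using tri_range tri_plane unfolding triang_on_def by blast
qed

text \<open>The triangle on the edge \<open>(i, j)\<close> cuts the polygon into two smaller ones,
  to which induction on \<open>j - i\<close> applies; its apex is the largest neighbour of
  \<open>i\<close> below \<open>j\<close>.\<close>

lemma triang_on_imp_tri:
  assumes "triang_on i j T" "i < j"
  shows "\<exists>t. j = i + nodes t + 1 \<and> T = tri t i"
  using assms
proof (induction "j - i" arbitrary: i j T rule: less_induct)
  case less
  have rng: "i \<le> a \<and> a < b \<and> b \<le> j" if "(a, b) \<in> T" for a b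
    using less.prems that unfolding triang_on_def by blast
  have pl: "plane T" using less.prems unfolding triang_on_def by blast
  have mx: "(a, b) \<in> T" if "i \<le> a" "a < b" "b \<le> j"
    "\<And>c d. (c, d) \<in> T \<Longrightarrow> \<not> crossing (a, b) (c, d)" for a b
    using less.prems(1) that unfolding triang_on_def by simp
  \<comment> \<open>No edge within the range from \<open>i\<close> to \<open>j\<close> can cross
    \<open>(i, j)\<close> or the side \<open>(i, Suc i)\<close>, so maximality supplies
    both.\<close>
  have top: "(i, j) \<in> T"
    using rng less.prems(2) by (intro mx) (force simp: crossing_def)+
  have side: "(i, Suc i) \<in> T"
    using rng less.prems(2) by (intro mx) (force simp: crossing_def)+
  show ?case
  proof (cases "j = Suc i")
    case True
    then have "T = {(i, Suc i)}" using side rng by fastforce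
    then show ?thesis using True by (intro exI[of _ Leaf]) simp
  next
    case False
    define k where "k = Max {k. (i, k) \<in> T \<and> k < j}"
    have fin: "finite {k. (i, k) \<in> T \<and> k < j}" by simp
    have "Suc i \<in> {k. (i, k) \<in> T \<and> k < j}" using False side less.prems(2) by simp
    then have k: "(i, k) \<in> T" "k < j"
      using Max_in[OF fin] unfolding k_def by blast+
    have kmax: "b \<le> k" if "(i, b) \<in> T" "b < j" for b
      using Max_ge[OF fin] that unfolding k_def by blast
    have ik: "i < k" using k rng by blast
    \<comment> \<open>An edge passing over \<open>k\<close> either starts at \<open>i\<close>, where
      the choice of \<open>k\<close> leaves only \<open>(i, j)\<close>, or starts later and crosses
      \<open>(i, k)\<close>.\<close>
    have nospan: "a = i \<and> b = j" if "(a, b) \<in> T" "a < k" "k < b" for a b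
    proof (cases "a = i")
      case True
      then show ?thesis using kmax[of b] rng[of a b] that by fastforce
    next
      case False
      then show ?thesis using planeD[OF pl k(1) that(1)] rng[OF that(1)] that by auto
    qed
    \<comment> \<open>An edge crossing \<open>(k, j)\<close> would pass over \<open>k\<close> and
      end before \<open>j\<close>, against \<open>nospan\<close>; so maximality closes the
      triangle.\<close>
    have kj: "(k, j) \<in> T"
    proof (intro mx)
      show "\<not> crossing (k, j) (c, d)" if "(c, d) \<in> T" for c d
        using nospan[OF that] rng[OF that] by (auto simp: crossing_def)
    qed (use ik k in simp_all)
    define L where "L = {e \<in> T. snd e \<le> k}"
    define R where "R = {e \<in> T. k \<le> fst e}"
    have T: "T = insert (i, j) (L \<union> R)"
      using nospan top unfolding L_def R_def by (fastforce simp: not_le)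
    have "triang_on i k L"
      unfolding triang_on_def
    proof (intro conjI allI impI)
      show "\<forall>(a, b)\<in>L. i \<le> a \<and> a < b \<and> b \<le> k" using rng unfolding L_def by auto
      show "plane L" using pl unfolding L_def plane_def by blast
      fix a b assume ab: "i \<le> a \<and> a < b \<and> b \<le> k \<and> (\<forall>c d. (c, d) \<in> L \<longrightarrow> \<not> crossing (a, b) (c, d))"
      \<comment> \<open>A chord between \<open>i\<close> and \<open>k\<close> crosses neither
        \<open>(i, j)\<close> nor an edge starting at \<open>k\<close> or later, so maximality in
        \<open>T\<close> restricts to maximality in \<open>L\<close>.\<close>
      have "\<not> crossing (a, b) (c, d)" if "(c, d) \<in> T" for c d
      proof -
        from that T consider "(c, d) = (i, j)" | "(c, d) \<in> L" | "(c, d) \<in> R" by blast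
        then show ?thesis
          using ab k rng[OF that] by cases (auto simp: R_def crossing_def)
      qed
      then have "(a, b) \<in> T" using ab k by (intro mx) auto
      then show "(a, b) \<in> L" using ab unfolding L_def by simp
    qed
    moreover have "k - i < j - i" using k ik by linarith
    ultimately obtain l where l: "k = i + nodes l + 1" "L = tri l i"
      using less.hyps[of k i L] k ik by auto
    have "triang_on k j R"
      unfolding triang_on_def
    proof (intro conjI allI impI)
      show "\<forall>(a, b)\<in>R. k \<le> a \<and> a < b \<and> b \<le> j" using rng unfolding R_def by auto
      show "plane R" using pl unfolding R_def plane_def by blast
      fix a b assume ab: "k \<le> a \<and> a < b \<and> b \<le> j \<and> (\<forall>c d. (c, d) \<in> R \<longrightarrow> \<not> crossing (a, b) (c, d))"
      have "\<not> crossing (a, b) (c, d)" if "(c, d) \<in> T" for c d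
      proof -
        from that T consider "(c, d) = (i, j)" | "(c, d) \<in> R" | "(c, d) \<in> L" by blast
        then show ?thesis
          using ab k ik rng[OF that] by cases (auto simp: L_def crossing_def)
      qed
      then have "(a, b) \<in> T" using ab ik by (intro mx) auto
      then show "(a, b) \<in> R" using ab unfolding R_def by simp
    qed
    moreover have "j - k < j - i" using k ik by linarith
    ultimately obtain r where r: "j = k + nodes r + 1" "R = tri r k"
      using less.hyps[of j k R] k ik by auto
    show ?thesis
      using T l r by (intro exI[of _ "Node l r"]) simp
  qed
qed

lemma triangulation_iff_tri: "triangulation (n + 2) T \<longleftrightarrow> (\<exists>t. nodes t = n \<and> T = tri t 1)"
proof
  assume "triangulation (n + 2) T"
  then show "\<exists>t. nodes t = n \<and> T = tri t 1"
    using triang_on_imp_tri[of 1 "n + 2" T] by (auto simp: triangulation_iff)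
next
  assume "\<exists>t. nodes t = n \<and> T = tri t 1"
  then obtain t where "nodes t = n" "T = tri t 1" by blast
  then show "triangulation (n + 2) T"
    using triang_on_tri[of 1 t] by (simp add: triangulation_iff)
qed

subsection \<open>Plane perfect matchings as binary trees\<close>

text \<open>The positions form the half-open range from \<open>i\<close> to \<open>j - 1\<close>, so
  \<open>i = j\<close> gives the empty matching. Having exactly one edge at each vertex is separated
  into covering and disjointness of arcs, which restrict to parts independently.\<close>

definition matching_on :: "nat \<Rightarrow> nat \<Rightarrow> edge set \<Rightarrow> bool" where
  "matching_on i j M \<longleftrightarrow>
     (\<forall>(a, b)\<in>M. i \<le> a \<and> a < b \<and> b < j) \<and> plane M \<and>
     (\<forall>v. i \<le> v \<and> v < j \<longrightarrow> (\<exists>a b. (a, b) \<in> M \<and> (v = a \<or> v = b))) \<and>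
     (\<forall>a b c d. (a, b) \<in> M \<and> (c, d) \<in> M \<and> (a = c \<or> a = d \<or> b = c \<or> b = d) \<longrightarrow>
        a = c \<and> b = d)"

lemma matching_on_unique:
  assumes "matching_on i j M" "(a, b) \<in> M" "(c, d) \<in> M" "a = c \<or> a = d \<or> b = c \<or> b = d"
  shows "a = c \<and> b = d"
proof -
  have "\<forall>a b c d. (a, b) \<in> M \<and> (c, d) \<in> M \<and> (a = c \<or> a = d \<or> b = c \<or> b = d) \<longrightarrow>
      a = c \<and> b = d"
    using assms(1) unfolding matching_on_def by (elim conjE)
  from this[rule_format, OF conjI[OF assms(2) conjI[OF assms(3,4)]]] show ?thesis .
qed

lemma plane_perfect_matching_iff:
  "plane_perfect_matching n M \<longleftrightarrow> matching_on 1 (2 * n + 1) M"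
proof
  assume M: "plane_perfect_matching n M"
  have sub: "1 \<le> a \<and> a < b \<and> b < 2 * n + 1" if "(a, b) \<in> M" for a b
    using M that unfolding plane_perfect_matching_def edges_def by fastforce
  have ex1: "\<exists>!e. e \<in> M \<and> (v = fst e \<or> v = snd e)" if "1 \<le> v" "v < 2 * n + 1" for v
    using M that unfolding plane_perfect_matching_def by simp
  have "a = c \<and> b = d"
    if "(a, b) \<in> M" "(c, d) \<in> M" "v = a \<or> v = b" "v = c \<or> v = d" for a b c d v
  proof -
    have "1 \<le> v \<and> v < 2 * n + 1"
      using sub[OF that(1)] that(3) by auto
    then have "\<exists>!e. e \<in> M \<and> (v = fst e \<or> v = snd e)" using ex1 by blast
    then have "(a, b) = (c, d)" using that by (metis fst_conv snd_conv)
    then show ?thesis by simp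
  qed
  then have "\<forall>a b c d. (a, b) \<in> M \<and> (c, d) \<in> M \<and> (a = c \<or> a = d \<or> b = c \<or> b = d) \<longrightarrow>
      a = c \<and> b = d"
    by blast
  moreover have "\<exists>a b. (a, b) \<in> M \<and> (v = a \<or> v = b)" if "1 \<le> v" "v < 2 * n + 1" for v
    using ex1[OF that] by (metis surj_pair fst_conv snd_conv)
  moreover have "plane M" using M unfolding plane_perfect_matching_def by blast
  ultimately show "matching_on 1 (2 * n + 1) M"
    using sub unfolding matching_on_def by blast
next
  assume M: "matching_on 1 (2 * n + 1) M"
  have "1 \<le> a \<and> a < b \<and> b < 2 * n + 1" if "(a, b) \<in> M" for a b
    using M that unfolding matching_on_def by blast
  then have sub: "M \<subseteq> edges (2 * n)" unfolding edges_def by fastforce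
  have ex1: "\<exists>!e. e \<in> M \<and> (v = fst e \<or> v = snd e)" if "v \<in> {1..2 * n}" for v
  proof -
    have "1 \<le> v" "v < 2 * n + 1" using that by auto
    then obtain a b where ab: "(a, b) \<in> M" "v = a \<or> v = b"
      using M unfolding matching_on_def by blast
    have uni: "c = a \<and> d = b" if "(c, d) \<in> M" "v = c \<or> v = d" for c d
    proof -
      have "a = c \<or> a = d \<or> b = c \<or> b = d" using ab(2) that(2) by blast
      then have "a = c \<and> b = d" using matching_on_unique[OF M ab(1) that(1)] by blast
      then show ?thesis by simp
    qed
    show ?thesis
    proof (intro ex1I[of _ "(a, b)"])
      show "(a, b) \<in> M \<and> (v = fst (a, b) \<or> v = snd (a, b))" using ab by simp
      show "e = (a, b)" if "e \<in> M \<and> (v = fst e \<or> v = snd e)" for e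
        using uni[of "fst e" "snd e"] that by (cases e) simp
    qed
  qed
  have pl: "plane M" using M unfolding matching_on_def by blast
  show "plane_perfect_matching n M"
    unfolding plane_perfect_matching_def by (intro conjI ballI sub pl ex1)
qed

lemma mat_range: "(a, b) \<in> mat t k \<Longrightarrow> k \<le> a \<and> a < b \<and> b < k + 2 * nodes t"
  by (induction t arbitrary: k) fastforce+

lemma mat_plane: "plane (mat t k)"
proof (induction t arbitrary: k)
  case Leaf
  then show ?case by (auto simp: plane_def)
next
  case (Node l r)
  let ?R = "mat r (k + 2 * nodes l + 2)"
  have "\<not> crossing e f" if "e \<in> mat l (k + 1)" "f \<in> ?R" for e f
    using that mat_range[of "fst e" "snd e" l "k + 1"]
      mat_range[of "fst f" "snd f" r "k + 2 * nodes l + 2"]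
    by (auto simp: crossing_def)
  then have "plane (mat l (k + 1) \<union> ?R)"
    using Node crossing_commute unfolding plane_def by blast
  moreover have "\<not> crossing (k, k + 2 * nodes l + 1) f" if "f \<in> mat l (k + 1) \<union> ?R" for f
    using that mat_range[of "fst f" "snd f" l "k + 1"]
      mat_range[of "fst f" "snd f" r "k + 2 * nodes l + 2"]
    by (auto simp: crossing_def)
  ultimately show ?case by (simp add: plane_insert)
qed

lemma mat_covers:
  "k \<le> v \<Longrightarrow> v < k + 2 * nodes t \<Longrightarrow> \<exists>a b. (a, b) \<in> mat t k \<and> (v = a \<or> v = b)"
proof (induction t arbitrary: k)
  case Leaf
  then show ?case by simp
next
  case (Node l r)
  consider "v = k" | "k + 1 \<le> v" "v < k + 1 + 2 * nodes l" | "v = k + 2 * nodes l + 1"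
    | "k + 2 * nodes l + 2 \<le> v"
    using Node.prems by linarith
  then show ?case
  proof cases
    case 2
    then show ?thesis using Node.IH(1)[of "k + 1"] by auto
  next
    case 4
    then show ?thesis using Node.IH(2)[of "k + 2 * nodes l + 2"] Node.prems by auto
  qed auto
qed

lemma mat_unique:
  "(a, b) \<in> mat t k \<Longrightarrow> (c, d) \<in> mat t k \<Longrightarrow> a = c \<or> a = d \<or> b = c \<or> b = d \<Longrightarrow> a = c \<and> b = d"
proof (induction t arbitrary: k)
  case Leaf
  then show ?case by simp
next
  case (Node l r)
  let ?m = "k + 2 * nodes l + 2"
  from Node.prems(1) consider "a = k \<and> b = k + 2 * nodes l + 1" | "(a, b) \<in> mat l (k + 1)"
    | "(a, b) \<in> mat r ?m" by auto
  then show ?case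
  proof cases
    case 1
    then show ?thesis
      using Node.prems mat_range[of c d l "k + 1"] mat_range[of c d r ?m] by auto
  next
    case 2
    then have "(c, d) \<in> mat l (k + 1)"
      using Node.prems mat_range[OF 2] mat_range[of c d r ?m] by auto
    then show ?thesis using Node.IH(1) 2 Node.prems by blast
  next
    case 3
    then have "(c, d) \<in> mat r ?m"
      using Node.prems mat_range[OF 3] mat_range[of c d l "k + 1"] by auto
    then show ?thesis using Node.IH(2) 3 Node.prems by blast
  qed
qed

lemma matching_on_mat: "matching_on k (k + 2 * nodes t) (mat t k)"
  unfolding matching_on_def
  using mat_range[of _ _ t k] mat_plane mat_covers[of k _ t] mat_unique[of _ _ t k] by blast

text \<open>The arc starting at the first position separates the others into those below it and
  those to its right; both parts are shorter plane perfect matchings, and they yield the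
  subtrees.\<close>

lemma matching_on_imp_mat:
  assumes "matching_on i j M" "i \<le> j"
  shows "\<exists>t. j = i + 2 * nodes t \<and> M = mat t i"
  using assms
proof (induction "j - i" arbitrary: i j M rule: less_induct)
  case less
  have rng: "i \<le> a \<and> a < b \<and> b < j" if "(a, b) \<in> M" for a b
    using less.prems that unfolding matching_on_def by blast
  have pl: "plane M" using less.prems unfolding matching_on_def by blast
  have cov: "\<exists>a b. (a, b) \<in> M \<and> (v = a \<or> v = b)" if "i \<le> v" "v < j" for v
    using less.prems(1) that unfolding matching_on_def by blast
  note uni = matching_on_unique[OF less.prems(1)]
  show ?case
  proof (cases "i = j")
    case True
    then have "M = {}" using rng by fastforce
    then show ?thesis using True by (intro exI[of _ Leaf]) simp
  next
    case False
    then obtain q where q: "(i, q) \<in> M" using cov[of i] rng less.prems(2) by fastforce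
    have iq: "i < q" "q < j" using rng q by blast+
    define L where "L = {e \<in> M. i < fst e \<and> snd e < q}"
    define R where "R = {e \<in> M. q < fst e}"
    \<comment> \<open>Disjointness keeps other arcs away from \<open>i\<close> and \<open>q\<close>,
      and planarity forbids an arc from below \<open>(i, q)\<close> to beyond
      \<open>q\<close>.\<close>
    have split: "(a, b) = (i, q) \<or> (a, b) \<in> L \<or> (a, b) \<in> R" if "(a, b) \<in> M" for a b
    proof -
      have "a = i \<Longrightarrow> b = q" "a \<noteq> q" "b = q \<Longrightarrow> a = i" using uni[OF q that] iq by auto
      moreover have "\<not> (a < q \<and> q < b \<and> i < a)" using planeD[OF pl q that] by blast
      moreover have "a \<noteq> i \<Longrightarrow> i < a" using rng[OF that] by simp
      ultimately have "a = i \<and> b = q \<or> i < a \<and> b < q \<or> q < a" by linarith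
      then show ?thesis using that unfolding L_def R_def by auto
    qed
    have M: "M = insert (i, q) (L \<union> R)"
    proof
      show "M \<subseteq> insert (i, q) (L \<union> R)" using split by auto
      show "insert (i, q) (L \<union> R) \<subseteq> M" using q unfolding L_def R_def by auto
    qed
    have "matching_on (i + 1) q L"
      unfolding matching_on_def
    proof (intro conjI)
      show "\<forall>(a, b)\<in>L. i + 1 \<le> a \<and> a < b \<and> b < q" using rng unfolding L_def by auto
      show "plane L" using pl unfolding L_def plane_def by blast
      show "\<forall>v. i + 1 \<le> v \<and> v < q \<longrightarrow> (\<exists>a b. (a, b) \<in> L \<and> (v = a \<or> v = b))"
      proof (intro allI impI)
        fix v assume v: "i + 1 \<le> v \<and> v < q"
        then obtain a b where ab: "(a, b) \<in> M" "v = a \<or> v = b" using cov[of v] iq by auto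
        then have "(a, b) \<in> L"
          using split[OF ab(1)] v rng[OF ab(1)] iq by (auto simp: R_def)
        then show "\<exists>a b. (a, b) \<in> L \<and> (v = a \<or> v = b)" using ab(2) by blast
      qed
      show "\<forall>a b c d. (a, b) \<in> L \<and> (c, d) \<in> L \<and> (a = c \<or> a = d \<or> b = c \<or> b = d) \<longrightarrow>
          a = c \<and> b = d"
        using uni unfolding L_def by blast
    qed
    moreover have "q - (i + 1) < j - i" using iq by linarith
    ultimately obtain l where l: "q = i + 1 + 2 * nodes l" "L = mat l (i + 1)"
      using less.hyps[of q "i + 1" L] iq by auto
    have "matching_on (q + 1) j R"
      unfolding matching_on_def
    proof (intro conjI)
      show "\<forall>(a, b)\<in>R. q + 1 \<le> a \<and> a < b \<and> b < j" using rng unfolding R_def by auto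
      show "plane R" using pl unfolding R_def plane_def by blast
      show "\<forall>v. q + 1 \<le> v \<and> v < j \<longrightarrow> (\<exists>a b. (a, b) \<in> R \<and> (v = a \<or> v = b))"
      proof (intro allI impI)
        fix v assume v: "q + 1 \<le> v \<and> v < j"
        then obtain a b where ab: "(a, b) \<in> M" "v = a \<or> v = b" using cov[of v] iq by auto
        then have "(a, b) \<in> R"
          using split[OF ab(1)] v rng[OF ab(1)] iq by (auto simp: L_def)
        then show "\<exists>a b. (a, b) \<in> R \<and> (v = a \<or> v = b)" using ab(2) by blast
      qed
      show "\<forall>a b c d. (a, b) \<in> R \<and> (c, d) \<in> R \<and> (a = c \<or> a = d \<or> b = c \<or> b = d) \<longrightarrow>
          a = c \<and> b = d"
        using uni unfolding R_def by blast
    qed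
    moreover have "j - (q + 1) < j - i" using iq by linarith
    ultimately obtain r where r: "j = q + 1 + 2 * nodes r" "R = mat r (q + 1)"
      using less.hyps[of j "q + 1" R] iq by auto
    show ?thesis
      using M l r by (intro exI[of _ "Node l r"]) (simp add: add.assoc)
  qed
qed

lemma plane_perfect_matching_iff_mat:
  "plane_perfect_matching n M \<longleftrightarrow> (\<exists>t. nodes t = n \<and> M = mat t 1)"
proof
  assume "plane_perfect_matching n M"
  then show "\<exists>t. nodes t = n \<and> M = mat t 1"
    using matching_on_imp_mat[of 1 "2 * n + 1" M] by (auto simp: plane_perfect_matching_iff)
next
  assume "\<exists>t. nodes t = n \<and> M = mat t 1"
  then obtain t where "nodes t = n" "M = mat t 1" by blast
  then show "plane_perfect_matching n M"
    using matching_on_mat[of 1 t] by (simp add: plane_perfect_matching_iff)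
qed

subsection \<open>The correspondence is equality of trees\<close>

primrec word :: "btree \<Rightarrow> bool list" where
  "word Leaf = []"
| "word (Node l r) = True # word l @ False # word r"

definition inc_hd :: "nat list \<Rightarrow> nat list" where
  "inc_hd xs = Suc (hd xs) # tl xs"

text \<open>Lengths of the runs of ones in front of the successive zeros of the word of a tree. The
  trailing \<open>0\<close> in \<open>runs l @ [0]\<close> is the run in front of the zero that closes the
  first arc; the one that opens this arc makes the first run longer by one.\<close>

primrec runs :: "btree \<Rightarrow> nat list" where
  "runs Leaf = []"
| "runs (Node l r) = inc_hd (runs l @ [0]) @ runs r"

definition of_runs :: "nat list \<Rightarrow> bool list" where
  "of_runs ds = concat (map (\<lambda>d. replicate d True @ [False]) ds)"

lemma nth_inc_hd: "0 < x \<Longrightarrow> xs \<noteq> [] \<Longrightarrow> inc_hd xs ! x = xs ! x"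
  by (cases xs) (simp_all add: inc_hd_def)

lemma length_word: "length (word t) = 2 * nodes t"
  by (induction t) auto

lemma length_runs: "length (runs t) = nodes t"
  by (induction t) (auto simp: inc_hd_def)

text \<open>The word \<open>W(l) 0\<close> has the runs \<open>runs l @ [0]\<close>, and a one put
  in front lengthens its first run.\<close>

lemma word_eq_of_runs: "word t = of_runs (runs t)"
proof (induction t)
  case Leaf
  then show ?case by (simp add: of_runs_def)
next
  case (Node l r)
  have "of_runs (inc_hd xs) = True # of_runs xs" if "xs \<noteq> []" for xs
    using that by (cases xs) (auto simp: of_runs_def inc_hd_def)
  then have "of_runs (inc_hd (runs l @ [0])) = True # of_runs (runs l @ [0])" by blast
  then show ?case using Node by (simp add: of_runs_def)
qed

text \<open>Unique parsing. The remainders are part of the claim because in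
  \<open>word (Node l r)\<close> the left word is followed by a zero; that a remainder is empty or
  starts with a zero marks where the word of the tree stops.\<close>

lemma word_append_inject:
  assumes "word s @ u = word t @ v" "u = [] \<or> \<not> hd u" "v = [] \<or> \<not> hd v"
  shows "s = t \<and> u = v"
  using assms
proof (induction s arbitrary: t u v)
  case Leaf
  then show ?case by (cases t) auto
next
  case (Node l r)
  have "t \<noteq> Leaf" using Node.prems(1,3) by auto
  then obtain l' r' where t: "t = Node l' r'" by (cases t) auto
  then have "word l @ False # word r @ u = word l' @ False # word r' @ v" using Node.prems by simp
  then have "l = l' \<and> False # word r @ u = False # word r' @ v" by (intro Node.IH(1)) auto
  then show ?case using Node.IH(2)[of u r' v] Node.prems t by simp
qed

lemma runs_inject: "runs s = runs t \<longleftrightarrow> s = t"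
  using word_append_inject[of s "[]" t "[]"] by (auto simp: word_eq_of_runs)

section \<open>Positions of zeros and ones in a word given by its run lengths\<close>

text \<open>Before block \<open>k\<close> stand \<open>k\<close> earlier zeros and all ones of the
  earlier runs, which gives the offset; \<open>x = ds ! k\<close> addresses the zero that closes the
  block.\<close>

lemma nth_of_runs:
  assumes "k < length ds" "x \<le> ds ! k"
  shows "k + sum_list (take k ds) + x < length (of_runs ds) \<and>
    (of_runs ds ! (k + sum_list (take k ds) + x) \<longleftrightarrow> x < ds ! k)"
  using assms
proof (induction ds arbitrary: k)
  case Nil
  then show ?case by simp
next
  case (Cons d ds)
  show ?case
  proof (cases k)
    case 0
    then show ?thesis using Cons.prems by (auto simp: of_runs_def nth_append)
  next
    case (Suc j)
    have w: "of_runs (d # ds) = (replicate d True @ [False]) @ of_runs ds" by (simp add: of_runs_def)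
    have "k + sum_list (take k (d # ds)) + x = Suc d + (j + sum_list (take j ds) + x)"
      using Suc by simp
    then show ?thesis
      using Cons.IH[of j] Cons.prems Suc unfolding w by (simp add: nth_append add.assoc)
  qed
qed

text \<open>The list is indexed from 0 and \<open>b\<close> from 1, so the position of the
  \<open>k\<close>-th zero equals the list index at which the next block starts. This also fits the
  convention that the zeroth zero is at position 0.\<close>

lemma zero_pos_of_runs:
  assumes b: "\<And>j. j < length (of_runs ds) \<Longrightarrow> b (Suc j) = (if of_runs ds ! j then 1 else 0)"
    and "k \<le> length ds"
  shows "zero_pos b k = k + sum_list (take k ds)"
  using assms(2)
proof (induction k)
  case 0
  then show ?case by simp
next
  case (Suc k)
  define z where "z = zero_pos b k"
  have z: "z = k + sum_list (take k ds)" using Suc by (simp add: z_def)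
  \<comment> \<open>The entries following the \<open>k\<close>-th zero: \<open>ds ! k\<close> ones
    and then a zero, which is therefore the one that \<open>LEAST\<close> finds.\<close>
  have bz: "b (Suc (z + x)) = (if x < ds ! k then 1 else 0)" if "x \<le> ds ! k" for x
    using nth_of_runs[of k ds x] b[of "z + x"] Suc.prems that by (simp add: z)
  have "(LEAST j. z < j \<and> b j = 0) = Suc (z + ds ! k)"
  proof (rule Least_equality)
    show "z < Suc (z + ds ! k) \<and> b (Suc (z + ds ! k)) = 0" using bz[of "ds ! k"] by simp
    fix j assume j: "z < j \<and> b j = 0"
    show "Suc (z + ds ! k) \<le> j"
    proof (rule ccontr)
      assume "\<not> Suc (z + ds ! k) \<le> j"
      then have "j - Suc z < ds ! k" using j by linarith
      then show False using bz[of "j - Suc z"] j by simp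
    qed
  qed
  then show ?case using Suc.prems z by (simp add: z_def[symmetric] take_Suc_conv_app_nth)
qed

text \<open>The positions strictly between two consecutive zeros are exactly one run, so all of them
  carry ones.\<close>

lemma card_ones_of_runs:
  assumes b: "\<And>j. j < length (of_runs ds) \<Longrightarrow> b (Suc j) = (if of_runs ds ! j then 1 else (0::nat))"
    and k: "k < length ds"
  shows "card {j. zero_pos b k < j \<and> j < zero_pos b (Suc k) \<and> b j = 1} = ds ! k"
proof -
  define z where "z = zero_pos b k"
  have z: "z = k + sum_list (take k ds)"
    using zero_pos_of_runs[OF b, of k] k unfolding z_def by simp
  have z': "zero_pos b (Suc k) = Suc (z + ds ! k)"
    using zero_pos_of_runs[OF b, of "Suc k"] k z by (simp add: take_Suc_conv_app_nth del: zero_pos.simps)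
  have "b j = 1" if "z < j" "j < Suc (z + ds ! k)" for j
    using nth_of_runs[of k ds "j - Suc z"] b[of "j - Suc 0"] k that by (simp add: z)
  then have "{j. zero_pos b k < j \<and> j < zero_pos b (Suc k) \<and> b j = 1} = {z<..<Suc (z + ds ! k)}"
    unfolding z' z_def[symmetric] by auto
  then show ?thesis by simp
qed

section \<open>Outdegrees of the matching and of the triangulation of a tree\<close>

text \<open>Position and letter are compared in the four zones of \<open>1 W(l) 0 W(r)\<close>: the
  start of the first arc, the part below it, its end, and the part to its right.\<close>

lemma fst_mat: "j < 2 * nodes t \<Longrightarrow> k + j \<in> fst ` mat t k \<longleftrightarrow> word t ! j"
proof (induction t arbitrary: j k)
  case Leaf
  then show ?case by simp
next
  case (Node l r)
  have l: "k + j \<in> fst ` mat l (k + 1) \<Longrightarrow> 1 \<le> j \<and> j < 1 + 2 * nodes l"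
    using mat_range[of _ _ l "k + 1"] by fastforce
  have r: "k + j \<in> fst ` mat r (k + 2 * nodes l + 2) \<Longrightarrow> 2 * nodes l + 2 \<le> j"
    using mat_range[of _ _ r "k + 2 * nodes l + 2"] by fastforce
  have eq: "k + j \<in> fst ` mat (Node l r) k \<longleftrightarrow>
      j = 0 \<or> k + j \<in> fst ` mat l (k + 1) \<or> k + j \<in> fst ` mat r (k + 2 * nodes l + 2)"
    by (auto simp: image_Un)
  consider "j = 0" | i where "j = Suc i" "i < 2 * nodes l" | "j = Suc (2 * nodes l)"
    | i where "j = 2 * nodes l + 2 + i" "i < 2 * nodes r"
  proof -
    assume "j = 0 \<Longrightarrow> thesis" "\<And>i. j = Suc i \<Longrightarrow> i < 2 * nodes l \<Longrightarrow> thesis"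
      "j = Suc (2 * nodes l) \<Longrightarrow> thesis"
      "\<And>i. j = 2 * nodes l + 2 + i \<Longrightarrow> i < 2 * nodes r \<Longrightarrow> thesis"
    moreover have "j = 0 \<or> (j = Suc (j - 1) \<and> j - 1 < 2 * nodes l) \<or> j = Suc (2 * nodes l) \<or>
      (j = 2 * nodes l + 2 + (j - (2 * nodes l + 2)) \<and> j - (2 * nodes l + 2) < 2 * nodes r)"
      using Node.prems by auto
    ultimately show thesis by blast
  qed
  then show ?case
  proof cases
    case 1
    then show ?thesis by simp
  next
    case 2
    then show ?thesis
      using Node.IH(1)[of i "k + 1"] r unfolding eq by (auto simp: nth_append length_word)
  next
    case 3
    then show ?thesis using l r unfolding eq by (auto simp: nth_append length_word)
  next
    case 4
    then show ?thesis
      using Node.IH(2)[of i "k + 2 * nodes l + 2"] l unfolding eq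
      by (auto simp: nth_append length_word add.assoc)
  qed
qed

lemma matching_outdegree_mat:
  assumes "j < 2 * nodes t"
  shows "matching_outdegree (mat t k) (k + j) = (if word t ! j then 1 else 0)"
proof (cases "word t ! j")
  case True
  then obtain b where b: "(k + j, b) \<in> mat t k" using fst_mat[OF assms, of k] by force
  have "e = (k + j, b)" if "e \<in> mat t k" "fst e = k + j" for e
    using mat_unique[OF b, of "fst e" "snd e"] that by (cases e) simp
  moreover have "fst (k + j, b) = k + j" by simp
  ultimately have "{e \<in> mat t k. fst e = k + j} = {(k + j, b)}"
    using b by blast
  then show ?thesis using True by (simp add: matching_outdegree_def)
next
  case False
  then have "fst e \<noteq> k + j" if "e \<in> mat t k" for e
    using fst_mat[OF assms, of k] that by (metis imageI)
  then have "{e \<in> mat t k. fst e = k + j} = {}" by blast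
  then have "matching_outdegree (mat t k) (k + j) = 0"
    unfolding matching_outdegree_def by (simp only: card.empty)
  then show ?thesis using False by simp
qed

text \<open>The bound on \<open>b\<close> discards the sides. The appended \<open>0\<close> belongs
  to the last but one vertex, whose only outgoing edge is a side; in the left subtree this vertex
  lies just before the apex. The top edge adds one at the first vertex, which is
  \<open>inc_hd\<close>; vertices from the apex on get their edges from \<open>r\<close>.\<close>

lemma card_tri_starts:
  "x \<le> nodes t \<Longrightarrow> card {b. i + x + 2 \<le> b \<and> (i + x, b) \<in> tri t i} = (runs t @ [0]) ! x"
proof (induction t arbitrary: i x)
  case Leaf
  then have "{b. i + x + 2 \<le> b \<and> (i + x, b) \<in> tri Leaf i} = {}" by auto
  then show ?case using Leaf
    by (metis append_Nil card.empty le_zero_eq nodes.simps(1) nth_Cons_0 runs.simps(1))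
next
  case (Node l r)
  let ?k = "i + nodes l + 1"
  let ?S = "\<lambda>t j. {b. i + x + 2 \<le> b \<and> (i + x, b) \<in> tri t j}"
  have runs: "runs (Node l r) @ [0] = inc_hd (runs l @ [0]) @ (runs r @ [0])" by simp
  have len: "length (inc_hd (runs l @ [0])) = Suc (nodes l)" by (simp add: inc_hd_def length_runs)
  show ?case
  proof (cases "x \<le> nodes l")
    case True
    then have r: "(i + x, b) \<notin> tri r ?k" for b using tri_range[of "i + x" b r ?k] by auto
    have IH: "card (?S l i) = (runs l @ [0]) ! x" using Node.IH(1) True by blast
    have fin: "finite (?S l i)"
    proof (rule finite_subset)
      show "?S l i \<subseteq> {..?k}" using tri_range[of "i + x" _ l i]
        by (metis (no_types, lifting) atMost_iff mem_Collect_eq subsetI)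
    qed simp
    show ?thesis
    proof (cases "x = 0")
      case True
      have "?S (Node l r) i = insert (i + nodes l + nodes r + 2) (?S l i)"
        using r True by auto
      moreover have "i + nodes l + nodes r + 2 \<notin> ?S l i"
        using tri_range[of "i + x" _ l i] by fastforce
      ultimately have "card (?S (Node l r) i) = Suc (card (?S l i))" using fin by simp
      then show ?thesis using True IH unfolding runs by (simp add: inc_hd_def hd_conv_nth)
    next
      case False
      have "?S (Node l r) i = ?S l i" using r False by auto
      then show ?thesis
        using IH len True False nth_inc_hd[of x "runs l @ [0]"] unfolding runs
        by (simp add: nth_append[of "inc_hd _"])
    qed
  next
    case False
    then have l: "(i + x, b) \<notin> tri l i" if "i + x + 2 \<le> b" for b
      using tri_range[of "i + x" b l i] that by auto
    define y where "y = x - nodes l - 1"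
    have y: "i + x = ?k + y" "y \<le> nodes r" "x = Suc (nodes l) + y"
      using False Node.prems by (auto simp: y_def)
    have "?S (Node l r) i = ?S r ?k" using l False by auto
    moreover have "card (?S r ?k) = (runs r @ [0]) ! y"
      unfolding y(1) by (rule Node.IH(2)[OF y(2)])
    ultimately show ?thesis using len y(3) unfolding runs by (simp add: nth_append)
  qed
qed

lemma triangulation_outdegree_tri:
  assumes "nodes t = n" "x < n"
  shows "triangulation_outdegree (n + 2) (tri t 1) (Suc x) = runs t ! x"
proof -
  have rng: "a < b \<and> b \<le> n + 2" if "(a, b) \<in> tri t 1" for a b
    using tri_range[OF that] assms by simp
  \<comment> \<open>Among these edges, those counted by the outdegree are the ones that are not
    sides \<open>(j, j + 1)\<close>; \<open>(1, n + 2)\<close> is among them because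
    \<open>x < n\<close> forces \<open>n\<close> to be positive.\<close>
  have bd: "(1 + x, b) \<notin> boundary_edges (n + 2) \<or> (1 + x, b) = (1, n + 2) \<longleftrightarrow> 1 + x + 2 \<le> b"
    if "(1 + x, b) \<in> tri t 1" for b
    using rng[OF that] assms by (auto simp: boundary_edges_def)
  have "{e \<in> tri t 1. fst e = Suc x \<and> (e \<notin> boundary_edges (n + 2) \<or> e = (1, n + 2))} =
      Pair (1 + x) ` {b. (1 + x, b) \<in> tri t 1 \<and>
        ((1 + x, b) \<notin> boundary_edges (n + 2) \<or> (1 + x, b) = (1, n + 2))}"
    by auto
  also have "{b. (1 + x, b) \<in> tri t 1 \<and>
        ((1 + x, b) \<notin> boundary_edges (n + 2) \<or> (1 + x, b) = (1, n + 2))} =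
      {b. 1 + x + 2 \<le> b \<and> (1 + x, b) \<in> tri t 1}"
    using bd by blast
  finally have "triangulation_outdegree (n + 2) (tri t 1) (Suc x) =
      card {b. 1 + x + 2 \<le> b \<and> (1 + x, b) \<in> tri t 1}"
    unfolding triangulation_outdegree_def by (simp add: card_image inj_on_def)
  also have "\<dots> = (runs t @ [0]) ! x"
    using assms by (intro card_tri_starts) simp
  finally show ?thesis using assms by (simp add: nth_append length_runs)
qed

text \<open>Both sides of the correspondence are run lengths, \<open>runs t\<close> for the
  triangulation and \<open>runs s\<close> for the matching, and run lengths determine the
  tree.\<close>

lemma corresponds_iff:
  assumes "nodes s = n" "nodes t = n"
  shows "corresponds n (mat s 1) (tri t 1) \<longleftrightarrow> s = t"
proof -
  have b: "matching_outdegree (mat s 1) (Suc j) = (if of_runs (runs s) ! j then 1 else 0)"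
    if "j < length (of_runs (runs s))" for j
    using matching_outdegree_mat[of j s 1] that by (simp add: word_eq_of_runs[symmetric] length_word)
  have "triangulation_outdegree (n + 2) (tri t 1) (Suc x) = runs t ! x \<and>
      card {j. zero_pos (matching_outdegree (mat s 1)) x < j \<and>
               j < zero_pos (matching_outdegree (mat s 1)) (Suc x) \<and>
               matching_outdegree (mat s 1) j = 1} = runs s ! x" if "x < n" for x
    using triangulation_outdegree_tri[OF assms(2) that] card_ones_of_runs[OF b, of x] that assms
    by (simp add: length_runs del: zero_pos.simps)
  \<comment> \<open>The indices from 1 to \<open>n\<close> are rewritten as successors of
    \<open>x < n\<close>, so that \<open>i - 1\<close> becomes \<open>x\<close>.\<close>
  then have "corresponds n (mat s 1) (tri t 1) \<longleftrightarrow> (\<forall>x<n. runs t ! x = runs s ! x)"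
    unfolding corresponds_def image_Suc_lessThan[symmetric] ball_simps diff_Suc_1
    by (simp add: Ball_def)
  also have "\<dots> \<longleftrightarrow> runs s = runs t"
    using assms by (auto simp: list_eq_iff_nth_eq length_runs)
  finally show ?thesis by (simp add: runs_inject)
qed

text \<open>Every candidate is the matching of some tree with \<open>n\<close> nodes, and
  \<open>corresponds_iff\<close> leaves only \<open>t\<close>; so the definite description has a
  unique witness.\<close>

lemma matching_of_tri: "nodes t = n \<Longrightarrow> matching_of n (tri t 1) = mat t 1"
  unfolding matching_of_def plane_perfect_matching_iff_mat
  by (rule the_equality) (auto simp: corresponds_iff simp del: One_nat_def)

lemma triangulation_of_mat: "nodes t = n \<Longrightarrow> triangulation_of n (mat t 1) = tri t 1"
  unfolding triangulation_of_def triangulation_iff_tri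
  by (rule the_equality) (auto simp: corresponds_iff simp del: One_nat_def)

subsection \<open>Diagonal flips are rotations\<close>

lemma tri_left: "(x, y) \<in> tri (Node l r) i \<Longrightarrow> y \<le> i + nodes l + 1 \<Longrightarrow> (x, y) \<in> tri l i"
  using tri_range[of x y r "i + nodes l + 1"] by auto

lemma tri_right:
  "(x, y) \<in> tri (Node l r) i \<Longrightarrow> i + nodes l + 1 \<le> x \<Longrightarrow> (x, y) \<in> tri r (i + nodes l + 1)"
  using tri_range[of x y l i] by auto

text \<open>No edge from \<open>i\<close> passes beyond the apex except the top edge, and no edge to
  the last vertex starts before the apex except the top edge. So only the apex is joined to both
  ends.\<close>

lemma tri_apex:
  assumes "(i, x) \<in> tri (Node l r) i" "(x, i + nodes l + nodes r + 2) \<in> tri (Node l r) i"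
    and "x < i + nodes l + nodes r + 2"
  shows "x = i + nodes l + 1"
proof (rule ccontr)
  assume ne: "x \<noteq> i + nodes l + 1"
  show False
  proof (cases "x < i + nodes l + 1")
    case True
    then show False
      using assms(2) tri_range[of x "i + nodes l + nodes r + 2" l i]
        tri_range[of x "i + nodes l + nodes r + 2" r "i + nodes l + 1"]
        tri_range[OF assms(1)]
      by auto
  next
    case False
    then show False
      using ne assms(1,3) tri_range[of i x l i] tri_range[of i x r "i + nodes l + 1"] by auto
  qed
qed

text \<open>The removed edge lies in neither the right subtree nor the top edge, so an exchange
  inside the left subtree is the same exchange in the whole polygon.\<close>

lemma tri_exchange_left:
  assumes "tri l' i = insert e' (tri l i - {e})" "nodes l' = nodes l" "e \<in> tri l i"
  shows "tri (Node l' r) i = insert e' (tri (Node l r) i - {e})"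
proof -
  have "e \<notin> tri r (i + nodes l + 1)" "e \<noteq> (i, i + nodes l + nodes r + 2)"
    using tri_range[of "fst e" "snd e" l i] tri_range[of "fst e" "snd e" r "i + nodes l + 1"] assms(3)
    by auto
  then show ?thesis using assms(1,2) by auto
qed

lemma tri_exchange_right:
  assumes "tri r' (i + nodes l + 1) = insert e' (tri r (i + nodes l + 1) - {e})"
    and "nodes r' = nodes r" "e \<in> tri r (i + nodes l + 1)"
  shows "tri (Node l r') i = insert e' (tri (Node l r) i - {e})"
proof -
  have "e \<notin> tri l i" "e \<noteq> (i, i + nodes l + nodes r + 2)"
    using tri_range[of "fst e" "snd e" l i] tri_range[of "fst e" "snd e" r "i + nodes l + 1"] assms(3)
    by auto
  then show ?thesis using assms(1,2) by auto
qed

text \<open>The corners of the quadrilateral are \<open>i < p < q < s\<close>. Both trees consist of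
  the same edges apart from its diagonal, which is \<open>(i, q)\<close> in one and
  \<open>(p, s)\<close> in the other.\<close>

lemma tri_rotate_root:
  fixes a b c :: btree and i :: nat
  defines "p \<equiv> i + nodes a + 1" and "q \<equiv> i + nodes a + nodes b + 2"
    and "s \<equiv> i + nodes a + nodes b + nodes c + 3"
  shows "tri (Node a (Node b c)) i = insert (p, s) (tri (Node (Node a b) c) i - {(i, q)})"
    and "tri (Node (Node a b) c) i = insert (i, q) (tri (Node a (Node b c)) i - {(p, s)})"
proof -
  have l: "tri (Node (Node a b) c) i = insert (i, q) (insert (i, s) (tri a i \<union> tri b p \<union> tri c q))"
    by (auto simp: p_def q_def s_def add_ac numeral_eq_Suc)
  have r: "tri (Node a (Node b c)) i = insert (p, s) (insert (i, s) (tri a i \<union> tri b p \<union> tri c q))"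
    by (auto simp: p_def q_def s_def add_ac numeral_eq_Suc)
  have "(i, q) \<notin> insert (i, s) (tri a i \<union> tri b p \<union> tri c q)"
    using tri_range[of i q a i] tri_range[of i q b p] tri_range[of i q c q]
    by (auto simp: p_def q_def s_def)
  moreover have "(p, s) \<notin> insert (i, s) (tri a i \<union> tri b p \<union> tri c q)"
    using tri_range[of p s a i] tri_range[of p s b p] tri_range[of p s c q]
    by (auto simp: p_def q_def s_def)
  ultimately show "tri (Node a (Node b c)) i = insert (p, s) (tri (Node (Node a b) c) i - {(i, q)})"
    and "tri (Node (Node a b) c) i = insert (i, q) (tri (Node a (Node b c)) i - {(p, s)})"
    unfolding l r by blast+
qed

text \<open>Both exchange equations and the sides in both triangulations are recorded, so that a
  rotation can be read as a flip from either of its trees.\<close>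

lemma rot_imp_flip:
  assumes "rot t t'"
  shows "\<exists>a b c d. a < b \<and> b < c \<and> c < d \<and>
      {(a, b), (b, c), (c, d), (a, d)} \<subseteq> tri t i \<inter> tri t' i \<and> (a, c) \<in> tri t i \<and> (b, d) \<in> tri t' i \<and>
      tri t' i = insert (b, d) (tri t i - {(a, c)}) \<and> tri t i = insert (a, c) (tri t' i - {(b, d)})"
  using assms
proof (induction arbitrary: i rule: rot.induct)
  case (root a b c)
  let ?p = "i + nodes a + 1"
  let ?q = "i + nodes a + nodes b + 2"
  let ?s = "i + nodes a + nodes b + nodes c + 3"
  have "(i, ?p) \<in> tri a i" "(?p, ?q) \<in> tri b ?p" "(?q, ?s) \<in> tri c ?q"
    using tri_top[of i a] tri_top[of ?p b] tri_top[of ?q c] by (simp_all add: add_ac numeral_eq_Suc)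
  then have "{(i, ?p), (?p, ?q), (?q, ?s), (i, ?s)} \<subseteq>
      tri (Node (Node a b) c) i \<inter> tri (Node a (Node b c)) i"
    by (auto simp: add_ac numeral_eq_Suc)
  moreover have "(i, ?q) \<in> tri (Node (Node a b) c) i" "(?p, ?s) \<in> tri (Node a (Node b c)) i"
    by (auto simp: add_ac numeral_eq_Suc)
  moreover have "i < ?p" "?p < ?q" "?q < ?s" by auto
  ultimately show ?case using tri_rotate_root[of a b c i] by blast
next
  case (left l l' r)
  from left.IH[of i] obtain a b c d where
    abcd: "a < b" "b < c" "c < d" "{(a, b), (b, c), (c, d), (a, d)} \<subseteq> tri l i \<inter> tri l' i"
      "(a, c) \<in> tri l i" "(b, d) \<in> tri l' i"
      "tri l' i = insert (b, d) (tri l i - {(a, c)})" "tri l i = insert (a, c) (tri l' i - {(b, d)})"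
    by blast
  have n: "nodes l' = nodes l" using rot_nodes left.hyps by blast
  show ?case
  proof (intro exI conjI)
    show "tri (Node l' r) i = insert (b, d) (tri (Node l r) i - {(a, c)})"
      by (rule tri_exchange_left[OF abcd(7) n abcd(5)])
    show "tri (Node l r) i = insert (a, c) (tri (Node l' r) i - {(b, d)})"
      by (rule tri_exchange_left[OF abcd(8) n[symmetric] abcd(6)])
    show "{(a, b), (b, c), (c, d), (a, d)} \<subseteq> tri (Node l r) i \<inter> tri (Node l' r) i"
      using abcd(4) by auto
  qed (use abcd(1-6) in auto)
next
  case (right r r' l)
  let ?k = "i + nodes l + 1"
  from right.IH[of ?k] obtain a b c d where
    abcd: "a < b" "b < c" "c < d" "{(a, b), (b, c), (c, d), (a, d)} \<subseteq> tri r ?k \<inter> tri r' ?k"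
      "(a, c) \<in> tri r ?k" "(b, d) \<in> tri r' ?k"
      "tri r' ?k = insert (b, d) (tri r ?k - {(a, c)})"
      "tri r ?k = insert (a, c) (tri r' ?k - {(b, d)})"
    by blast
  have n: "nodes r' = nodes r" using rot_nodes right.hyps by blast
  show ?case
  proof (intro exI conjI)
    show "tri (Node l r') i = insert (b, d) (tri (Node l r) i - {(a, c)})"
      by (rule tri_exchange_right[OF abcd(7) n abcd(5)])
    show "tri (Node l r) i = insert (a, c) (tri (Node l r') i - {(b, d)})"
      by (rule tri_exchange_right[OF abcd(8) n[symmetric] abcd(6)])
    show "{(a, b), (b, c), (c, d), (a, d)} \<subseteq> tri (Node l r) i \<inter> tri (Node l r') i"
      using abcd(4) by auto
  qed (use abcd(1-6) in auto)
qed

text \<open>The outer side \<open>(a, d)\<close> decides: it is the top edge or lies in one subtree.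
  In the latter case the other sides and the diagonal, having endpoints between \<open>a\<close> and
  \<open>d\<close>, lie in the same subtree.\<close>

lemma quadrilateral_position [consumes 6, case_names top left right]:
  assumes "{(a, b), (b, c), (c, d), (a, d)} \<subseteq> tri (Node l r) i" "e \<in> tri (Node l r) i"
    and "a < b" "b < c" "c < d" "e = (a, c) \<or> e = (b, d)"
  obtains "a = i" "d = i + nodes l + nodes r + 2"
  | "{(a, b), (b, c), (c, d), (a, d)} \<subseteq> tri l i" "e \<in> tri l i"
  | "{(a, b), (b, c), (c, d), (a, d)} \<subseteq> tri r (i + nodes l + 1)" "e \<in> tri r (i + nodes l + 1)"
proof -
  have mem: "(a, b) \<in> tri (Node l r) i" "(b, c) \<in> tri (Node l r) i" "(c, d) \<in> tri (Node l r) i"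
      "(a, d) \<in> tri (Node l r) i" "(fst e, snd e) \<in> tri (Node l r) i"
    using assms(1,2) by (auto simp del: tri.simps)
  from mem(4) consider "a = i" "d = i + nodes l + nodes r + 2" | "(a, d) \<in> tri l i"
    | "(a, d) \<in> tri r (i + nodes l + 1)" by auto
  then show thesis
  proof cases
    case 1
    then show thesis by (rule that(1))
  next
    case 2
    then have "d \<le> i + nodes l + 1" using tri_range by blast
    then have "{(a, b), (b, c), (c, d), (a, d)} \<subseteq> tri l i" "e \<in> tri l i"
      using mem[THEN tri_left] assms(3-6) by auto
    then show thesis by (rule that(2))
  next
    case 3
    then have "i + nodes l + 1 \<le> a" using tri_range by blast
    then have "{(a, b), (b, c), (c, d), (a, d)} \<subseteq> tri r (i + nodes l + 1)"
      "e \<in> tri r (i + nodes l + 1)"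
      using mem[THEN tri_right] assms(3-6) by auto
    then show thesis by (rule that(3))
  qed
qed

text \<open>A quadrilateral on the top edge is flipped by a rotation at the root; any other lies in
  a subtree and is handled by induction.\<close>

lemma flip_imp_rot:
  assumes "{(a, b), (b, c), (c, d), (a, d)} \<subseteq> tri t i" "(a, c) \<in> tri t i"
    and "a < b" "b < c" "c < d"
  shows "\<exists>t'. rot t t' \<and> tri t' i = insert (b, d) (tri t i - {(a, c)})"
  using assms(1,2)
proof (induction t arbitrary: i)
  case Leaf
  then show ?case using assms(3-5) by auto
next
  case (Node l r)
  have mem: "(a, b) \<in> tri (Node l r) i" "(b, c) \<in> tri (Node l r) i" "(c, d) \<in> tri (Node l r) i"
    using Node.prems(1) by blast+
  have "(a, c) = (a, c) \<or> (a, c) = (b, d)" by simp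
  from Node.prems assms(3-5) this show ?case
  proof (cases rule: quadrilateral_position)
    case top
    \<comment> \<open>The diagonal \<open>(a, c)\<close> and the side \<open>(c, d)\<close> join
      \<open>c\<close> to both ends of the top edge. In the same way \<open>b\<close> becomes the
      apex of the left subtree, which makes that subtree a node.\<close>
    have c: "c = i + nodes l + 1"
      using Node.prems(2) mem(3) assms(5) top
      by (intro tri_apex[of i c l r]) (simp_all del: tri.simps)
    have ab: "(a, b) \<in> tri l i" "(b, c) \<in> tri l i"
      using mem(1,2)[THEN tri_left] assms(4) c by auto
    then obtain l1 l2 where l: "l = Node l1 l2" using assms(3,4) by (cases l) auto
    have "c = i + nodes l1 + nodes l2 + 2" using c l by simp
    then have b: "b = i + nodes l1 + 1"
      using ab assms(4) unfolding l top by (intro tri_apex[of i b l1 l2]) simp_all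
    have "tri (Node l1 (Node l2 r)) i = insert (b, d) (tri (Node l r) i - {(a, c)})"
      using tri_rotate_root(1)[of l1 l2 r i] b c top unfolding l
      by (simp add: add_ac numeral_eq_Suc del: tri.simps)
    then show ?thesis unfolding l by (blast intro: rot.root)
  next
    case left
    then obtain l' where "rot l l'" "tri l' i = insert (b, d) (tri l i - {(a, c)})"
      using Node.IH(1) by blast
    then show ?thesis
      using tri_exchange_left[OF _ rot_nodes left(2)] rot.left by blast
  next
    case right
    then obtain r' where "rot r r'"
      "tri r' (i + nodes l + 1) = insert (b, d) (tri r (i + nodes l + 1) - {(a, c)})"
      using Node.IH(2) by blast
    then show ?thesis
      using tri_exchange_right[OF _ rot_nodes right(2)] rot.right by blast
  qed
qed

text \<open>Mirror image of \<open>flip_imp_rot\<close>: with the diagonal \<open>(b, d)\<close>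
  present, \<open>b\<close> is the apex of the root and \<open>c\<close> that of the right
  subtree.\<close>

lemma flip_imp_rot_converse:
  assumes "{(a, b), (b, c), (c, d), (a, d)} \<subseteq> tri t i" "(b, d) \<in> tri t i"
    and "a < b" "b < c" "c < d"
  shows "\<exists>t'. rot t' t \<and> tri t' i = insert (a, c) (tri t i - {(b, d)})"
  using assms(1,2)
proof (induction t arbitrary: i)
  case Leaf
  then show ?case using assms(3-5) by auto
next
  case (Node l r)
  let ?k = "i + nodes l + 1"
  have mem: "(a, b) \<in> tri (Node l r) i" "(b, c) \<in> tri (Node l r) i" "(c, d) \<in> tri (Node l r) i"
    using Node.prems(1) by blast+
  have "(b, d) = (a, c) \<or> (b, d) = (b, d)" by simp
  from Node.prems assms(3-5) this show ?case
  proof (cases rule: quadrilateral_position)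
    case top
    have b: "b = ?k"
      using mem(1) Node.prems(2) order.strict_trans[OF assms(4,5)] top
      by (intro tri_apex[of i b l r]) (simp_all del: tri.simps)
    have cd: "(b, c) \<in> tri r ?k" "(c, d) \<in> tri r ?k"
      using mem(2,3)[THEN tri_right] assms(4) b by auto
    then obtain r1 r2 where r: "r = Node r1 r2" using assms(4,5) by (cases r) auto
    have "d = ?k + nodes r1 + nodes r2 + 2" using top r by simp
    then have c: "c = ?k + nodes r1 + 1"
      using cd assms(5) unfolding r b by (intro tri_apex[of ?k c r1 r2]) simp_all
    have "tri (Node (Node l r1) r2) i = insert (a, c) (tri (Node l r) i - {(b, d)})"
      using tri_rotate_root(2)[of l r1 r2 i] b c top unfolding r
      by (simp add: add_ac numeral_eq_Suc del: tri.simps)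
    then show ?thesis unfolding r by (blast intro: rot.root)
  next
    case left
    then obtain l' where "rot l' l" "tri l' i = insert (a, c) (tri l i - {(b, d)})"
      using Node.IH(1) by blast
    then show ?thesis
      using tri_exchange_left[OF _ rot_nodes[symmetric] left(2)] rot.left by blast
  next
    case right
    then obtain r' where "rot r' r" "tri r' ?k = insert (a, c) (tri r ?k - {(b, d)})"
      using Node.IH(2) by blast
    then show ?thesis
      using tri_exchange_right[OF _ rot_nodes[symmetric] right(2)] rot.right by blast
  qed
qed

lemma diagonal_flip_tri_iff:
  "diagonal_flip (tri t i) T' \<longleftrightarrow> (\<exists>t'. (rot t t' \<or> rot t' t) \<and> T' = tri t' i)"
proof
  assume "diagonal_flip (tri t i) T'"
  then obtain a b c d where q: "{(a, b), (b, c), (c, d), (a, d)} \<subseteq> tri t i"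
      "a < b" "b < c" "c < d"
    and "(a, c) \<in> tri t i \<and> T' = insert (b, d) (tri t i - {(a, c)}) \<or>
      (b, d) \<in> tri t i \<and> T' = insert (a, c) (tri t i - {(b, d)})"
    unfolding diagonal_flip_def by blast
  from this(5) show "\<exists>t'. (rot t t' \<or> rot t' t) \<and> T' = tri t' i"
  proof (elim disjE conjE)
    assume "(a, c) \<in> tri t i" "T' = insert (b, d) (tri t i - {(a, c)})"
    with flip_imp_rot[OF q(1) _ q(2-4)] show ?thesis by auto
  next
    assume "(b, d) \<in> tri t i" "T' = insert (a, c) (tri t i - {(b, d)})"
    with flip_imp_rot_converse[OF q(1) _ q(2-4)] show ?thesis by auto
  qed
next
  assume "\<exists>t'. (rot t t' \<or> rot t' t) \<and> T' = tri t' i"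
  then obtain t' where "rot t t' \<or> rot t' t" and T': "T' = tri t' i" by blast
  from this(1) show "diagonal_flip (tri t i) T'"
  proof
    assume "rot t t'"
    from rot_imp_flip[OF this, of i] obtain a b c d where abcd: "a < b" "b < c" "c < d"
      "{(a, b), (b, c), (c, d), (a, d)} \<subseteq> tri t i \<inter> tri t' i" "(a, c) \<in> tri t i" "(b, d) \<in> tri t' i"
      "tri t' i = insert (b, d) (tri t i - {(a, c)})" "tri t i = insert (a, c) (tri t' i - {(b, d)})"
      by blast
    then have "{(a, b), (b, c), (c, d), (a, d)} \<subseteq> tri t i" by blast
    with abcd(1-3,5,7) show ?thesis unfolding diagonal_flip_def T' by blast
  next
    assume "rot t' t"
    from rot_imp_flip[OF this, of i] obtain a b c d where abcd: "a < b" "b < c" "c < d"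
      "{(a, b), (b, c), (c, d), (a, d)} \<subseteq> tri t' i \<inter> tri t i" "(a, c) \<in> tri t' i" "(b, d) \<in> tri t i"
      "tri t i = insert (b, d) (tri t' i - {(a, c)})" "tri t' i = insert (a, c) (tri t i - {(b, d)})"
      by blast
    then have "{(a, b), (b, c), (c, d), (a, d)} \<subseteq> tri t i" by blast
    with abcd(1-3,6,8) show ?thesis unfolding diagonal_flip_def T' by blast
  qed
qed

subsection \<open>Merges and splits are rotations\<close>

text \<open>The outcome of a merge as a function of the endpoints involved, \<open>i\<close> being
  the start of the section that moves. This isolates the set computation from the existential
  conditions of \<open>merge_for\<close>.\<close>

definition merge_result :: "edge set \<Rightarrow> nat \<Rightarrow> nat \<Rightarrow> nat \<Rightarrow> edge set" where
  "merge_result M i p q = (M - section_arcs M (i, p - 1) - {(p, q)})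
     \<union> (\<lambda>(a, b). (a + 1, b + 1)) ` section_arcs M (i, p - 1) \<union> {(i, q)}"

definition split_result :: "edge set \<Rightarrow> nat \<Rightarrow> nat \<Rightarrow> nat \<Rightarrow> edge set" where
  "split_result M p q r = (M - section_arcs M (p, q) - {(p - 1, r)})
     \<union> (\<lambda>(a, b). (a - 1, b - 1)) ` section_arcs M (p, q) \<union> {(q, r)}"

lemma section_arcs_Un: "section_arcs (X \<union> L) e = section_arcs X e \<union> section_arcs L e"
  by (auto simp: section_arcs_def)

section \<open>Merges and splits act locally\<close>

text \<open>All arcs that are removed, shifted or replaced belong to \<open>L\<close>, so the arcs
  of \<open>X\<close> are carried along unchanged.\<close>

lemma merge_result_Un:
  assumes "section_arcs X (i, p - 1) = {}" "(p, q) \<notin> X"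
  shows "merge_result (X \<union> L) i p q = X \<union> merge_result L i p q"
proof -
  have "X \<inter> section_arcs L (i, p - 1) = {}"
    using assms(1) unfolding section_arcs_def by blast
  then have "(X \<union> L) - section_arcs L (i, p - 1) - {(p, q)} = X \<union> (L - section_arcs L (i, p - 1) - {(p, q)})"
    using assms(2) by blast
  then show ?thesis
    unfolding merge_result_def section_arcs_Un assms(1) Un_empty_left by (simp only: Un_assoc)
qed

lemma split_result_Un:
  assumes "section_arcs X (p, q) = {}" "(p - 1, r) \<notin> X"
  shows "split_result (X \<union> L) p q r = X \<union> split_result L p q r"
proof -
  have "X \<inter> section_arcs L (p, q) = {}"
    using assms(1) unfolding section_arcs_def by blast
  then have "(X \<union> L) - section_arcs L (p, q) - {(p - 1, r)} = X \<union> (L - section_arcs L (p, q) - {(p - 1, r)})"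
    using assms(2) by blast
  then show ?thesis
    unfolding split_result_def section_arcs_Un assms(1) Un_empty_left by (simp only: Un_assoc)
qed

lemma mat_Suc: "(\<lambda>(a, b). (a + 1, b + 1)) ` mat t k = mat t (k + 1)"
  by (induction t arbitrary: k) (auto simp: image_Un)

text \<open>Truncated subtraction is harmless, since all positions are successors and the map undoes
  \<open>mat_Suc\<close>.\<close>

lemma mat_pred: "(\<lambda>(a, b). (a - 1, b - 1)) ` mat t (k + 1) = mat t k"
  unfolding mat_Suc[symmetric] image_image by (auto simp: case_prod_unfold)

text \<open>Isolates the left subtree, so that the root arc and the right subtree can serve as
  \<open>X\<close> in the locality lemmas.\<close>

lemma mat_Node_left:
  "mat (Node l r) k = insert (k, k + 2 * nodes l + 1) (mat r (k + 2 * nodes l + 2)) \<union> mat l (k + 1)"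
  by auto

lemma mat_Node_right:
  "mat (Node l r) k = insert (k, k + 2 * nodes l + 1) (mat l (k + 1)) \<union> mat r (k + 2 * nodes l + 2)"
  by auto

lemma outside_left:
  assumes "(x, y) \<in> mat l (k + 1)"
  shows "section_arcs (insert (k, m) (mat r (k + 2 * nodes l + 2))) (x, y) = {}"
    and "(x, y) \<notin> insert (k, m) (mat r (k + 2 * nodes l + 2))"
  using mat_range[OF assms] mat_range[of _ _ r "k + 2 * nodes l + 2"]
  by (fastforce simp: section_arcs_def)+

lemma outside_right:
  assumes "(x, y) \<in> mat r (k + 2 * nodes l + 2)"
  shows "section_arcs (insert (k, m) (mat l (k + 1))) (x, y) = {}"
    and "(x, y) \<notin> insert (k, m) (mat l (k + 1))"
  using mat_range[OF assms] mat_range[of _ _ l "k + 1"]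
  by (fastforce simp: section_arcs_def)+

lemma merge_result_left:
  assumes "(p, q) \<in> mat l (k + 1)" "(i, p - 1) \<in> mat l (k + 1)" "nodes l' = nodes l"
    and "mat l' (k + 1) = merge_result (mat l (k + 1)) i p q"
  shows "mat (Node l' r) k = merge_result (mat (Node l r) k) i p q"
  unfolding mat_Node_left assms(3,4)
  using merge_result_Un[OF outside_left(1)[OF assms(2)] outside_left(2)[OF assms(1)]] by simp

lemma merge_result_right:
  assumes "(p, q) \<in> mat r (k + 2 * nodes l + 2)" "(i, p - 1) \<in> mat r (k + 2 * nodes l + 2)"
    and "mat r' (k + 2 * nodes l + 2) = merge_result (mat r (k + 2 * nodes l + 2)) i p q"
  shows "mat (Node l r') k = merge_result (mat (Node l r) k) i p q"
  unfolding mat_Node_right assms(3)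
  using merge_result_Un[OF outside_right(1)[OF assms(2)] outside_right(2)[OF assms(1)]] by simp

lemma split_result_left:
  assumes "(p, q) \<in> mat l (k + 1)" "(p - 1, r) \<in> mat l (k + 1)" "nodes l' = nodes l"
    and "mat l' (k + 1) = split_result (mat l (k + 1)) p q r"
  shows "mat (Node l' t) k = split_result (mat (Node l t) k) p q r"
  unfolding mat_Node_left assms(3,4)
  using split_result_Un[OF outside_left(1)[OF assms(1)] outside_left(2)[OF assms(2)]] by simp

lemma split_result_right:
  assumes "(p, q) \<in> mat t (k + 2 * nodes l + 2)" "(p - 1, r) \<in> mat t (k + 2 * nodes l + 2)"
    and "mat t' (k + 2 * nodes l + 2) = split_result (mat t (k + 2 * nodes l + 2)) p q r"
  shows "mat (Node l t') k = split_result (mat (Node l t) k) p q r"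
  unfolding mat_Node_right assms(3)
  using split_result_Un[OF outside_right(1)[OF assms(1)] outside_right(2)[OF assms(2)]] by simp

section \<open>Merge and split at the root\<close>

text \<open>A rotation at the root keeps \<open>b\<close> and \<open>c\<close> in place, shifts
  \<open>a\<close> by one, and rearranges the two outer arcs. Position \<open>q\<close> ends the
  inner arc in the first matching and starts the second outer arc in the other.\<close>

lemma mat_rotate:
  assumes q: "q = k + 2 * nodes a + 2" and r: "r = q + 2 * nodes b + 1"
  shows "mat (Node (Node a b) c) k =
      insert (k, r) (insert (k + 1, q) (mat a (k + 2) \<union> (mat b (q + 1) \<union> mat c (r + 1))))"
    and "mat (Node a (Node b c)) k =
      insert (k, q - 1) (insert (q, r) (mat a (k + 1) \<union> (mat b (q + 1) \<union> mat c (r + 1))))"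
proof -
  have e: "k + 2 * nodes (Node a b) + 1 = r" "k + 2 * nodes (Node a b) + 2 = r + 1"
    "k + 1 + 1 = k + 2" "k + 1 + 2 * nodes a + 1 = q" "k + 1 + 2 * nodes a + 2 = q + 1"
    "k + 2 * nodes a + 1 = q - 1" "k + 2 * nodes a + 2 = q" "q + 2 * nodes b + 1 = r"
    "q + 2 * nodes b + 2 = r + 1"
    using q r by simp_all
  show "mat (Node (Node a b) c) k =
      insert (k, r) (insert (k + 1, q) (mat a (k + 2) \<union> (mat b (q + 1) \<union> mat c (r + 1))))"
    unfolding mat.simps e by blast
  show "mat (Node a (Node b c)) k =
      insert (k, q - 1) (insert (q, r) (mat a (k + 1) \<union> (mat b (q + 1) \<union> mat c (r + 1))))"
    unfolding mat.simps e by blast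
qed

text \<open>Here \<open>insert f A\<close> is the section, \<open>e\<close> the replaced arc and
  \<open>D\<close> what stays fixed; the two forms follow the order of insertion in
  \<open>mat_rotate\<close>.\<close>

lemma Diff_insert_Un_cancel:
  assumes "D \<inter> insert e (insert f A) = {}"
  shows "insert e (insert f (A \<union> D)) - insert f A - {e} = D"
    and "insert f (insert e (A \<union> D)) - insert f A - {e} = D"
  using assms by blast+

text \<open>The section of \<open>(k + 1, q)\<close> consists of this arc and \<open>a\<close>.
  Moved to the left it starts at \<open>k\<close>, which frees \<open>q\<close> as the new start of
  the arc ending at \<open>r\<close>.\<close>

lemma split_result_root:
  assumes q: "q = k + 2 * nodes a + 2" and r: "r = q + 2 * nodes b + 1"
  shows "split_result (mat (Node (Node a b) c) k) (k + 1) q r = mat (Node a (Node b c)) k"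
proof -
  let ?A = "mat a (k + 2)" and ?D = "mat b (q + 1) \<union> mat c (r + 1)"
  note M = mat_rotate[OF q r, of c]
  have rng: "(x, y) \<in> ?A \<Longrightarrow> k + 2 \<le> x \<and> y < q" "(x, y) \<in> ?D \<Longrightarrow> q < x" for x y
    using mat_range[of x y a "k + 2"] mat_range[of x y b "q + 1"] mat_range[of x y c "r + 1"] q r
    by auto
  have sec: "section_arcs (mat (Node (Node a b) c) k) (k + 1, q) = insert (k + 1, q) ?A"
    unfolding M(1) section_arcs_def using q rng(1) rng(2) mat_range[of _ _ a "k + 2"] by fastforce
  have disj: "?D \<inter> insert (k, r) (insert (k + 1, q) ?A) = {}"
    using rng(2) rng(1) mat_range[of _ _ a "k + 2"] q by fastforce
  have sh: "(\<lambda>(a, b). (a - 1, b - 1)) ` insert (k + 1, q) ?A = insert (k, q - 1) (mat a (k + 1))"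
    using mat_pred[of a "k + 1"] by simp
  show ?thesis
    unfolding split_result_def sec sh unfolding M add_diff_cancel_right' Diff_insert_Un_cancel(1)[OF disj]
    by blast
qed

text \<open>The section of \<open>(k, q - 1)\<close> consists of this arc and \<open>a\<close>.
  Moved to the right it ends at \<open>q\<close>, and the arc ending at \<open>r\<close> takes over
  the start \<open>k\<close>.\<close>

lemma merge_result_root:
  assumes q: "q = k + 2 * nodes a + 2" and r: "r = q + 2 * nodes b + 1"
  shows "merge_result (mat (Node a (Node b c)) k) k q r = mat (Node (Node a b) c) k"
proof -
  let ?A = "mat a (k + 1)" and ?D = "mat b (q + 1) \<union> mat c (r + 1)"
  note M = mat_rotate[OF q r, of c]
  have rng: "(x, y) \<in> ?A \<Longrightarrow> k + 1 \<le> x \<and> x < y \<and> y < q - 1" "(x, y) \<in> ?D \<Longrightarrow> q < x" for x y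
    using mat_range[of x y a "k + 1"] mat_range[of x y b "q + 1"] mat_range[of x y c "r + 1"] q r
    by auto
  have sec: "section_arcs (mat (Node a (Node b c)) k) (k, q - 1) = insert (k, q - 1) ?A"
    unfolding M(2) section_arcs_def using q rng by fastforce
  have disj: "?D \<inter> insert (q, r) (insert (k, q - 1) ?A) = {}"
    using rng q by fastforce
  have sh: "(\<lambda>(a, b). (a + 1, b + 1)) ` insert (k, q - 1) ?A = insert (k + 1, q) (mat a (k + 2))"
    using mat_Suc[of a "k + 1"] q by simp
  show ?thesis
    unfolding merge_result_def sec sh unfolding M Diff_insert_Un_cancel(2)[OF disj] by blast
qed

section \<open>Rotations of a tree and the merges and splits of its matching\<close>

text \<open>The root case is explicit and locality lifts splits from subtrees. The bound
  \<open>k < p\<close> becomes \<open>p > 1\<close> at \<open>k = 1\<close>.\<close>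

lemma rot_imp_split:
  assumes "rot t t'"
  shows "\<exists>p q r. (p, q) \<in> mat t k \<and> k < p \<and> (p - 1, r) \<in> mat t k \<and> mat t' k = split_result (mat t k) p q r"
  using assms
proof (induction arbitrary: k rule: rot.induct)
  case (root a b c)
  define q where q: "q = k + 2 * nodes a + 2"
  define r where r: "r = q + 2 * nodes b + 1"
  have "(k + 1, q) \<in> mat (Node (Node a b) c) k" "(k + 1 - 1, r) \<in> mat (Node (Node a b) c) k"
    unfolding mat_rotate(1)[OF q r] by simp_all
  then show ?case using split_result_root[OF q r, symmetric] less_add_one by blast
next
  case (left l l' t)
  from left.IH[of "k + 1"] obtain p q r where
    pqr: "(p, q) \<in> mat l (k + 1)" "k + 1 < p" "(p - 1, r) \<in> mat l (k + 1)"
      "mat l' (k + 1) = split_result (mat l (k + 1)) p q r" by blast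
  from pqr(1,3) have "(p, q) \<in> mat (Node l t) k" "(p - 1, r) \<in> mat (Node l t) k" by simp_all
  moreover have "mat (Node l' t) k = split_result (mat (Node l t) k) p q r"
    by (rule split_result_left[OF pqr(1,3) rot_nodes[OF left.hyps] pqr(4)])
  moreover have "k < p" using pqr(2) by simp
  ultimately show ?case by blast
next
  case (right t t' l)
  let ?k = "k + 2 * nodes l + 2"
  from right.IH[of ?k] obtain p q r where
    pqr: "(p, q) \<in> mat t ?k" "?k < p" "(p - 1, r) \<in> mat t ?k"
      "mat t' ?k = split_result (mat t ?k) p q r" by blast
  from pqr(1,3) have "(p, q) \<in> mat (Node l t) k" "(p - 1, r) \<in> mat (Node l t) k" by simp_all
  moreover have "mat (Node l t') k = split_result (mat (Node l t) k) p q r"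
    by (rule split_result_right[OF pqr(1,3,4)])
  moreover have "k < p" using pqr(2) by simp
  ultimately show ?case by blast
qed

text \<open>The induction runs over the rotation from \<open>t'\<close> to \<open>t\<close>, hence
  undoes it. The bound \<open>k + 1 < p\<close> becomes the requirement \<open>p > 2\<close> of a
  merge at \<open>k = 1\<close>.\<close>

lemma rot_imp_merge:
  assumes "rot t' t"
  shows "\<exists>i p q. (p, q) \<in> mat t k \<and> k + 1 < p \<and> (i, p - 1) \<in> mat t k \<and> mat t' k = merge_result (mat t k) i p q"
  using assms
proof (induction arbitrary: k rule: rot.induct)
  case (root a b c)
  define q where q: "q = k + 2 * nodes a + 2"
  define r where r: "r = q + 2 * nodes b + 1"
  have "(q, r) \<in> mat (Node a (Node b c)) k" "(k, q - 1) \<in> mat (Node a (Node b c)) k"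
    unfolding mat_rotate(2)[OF q r] by simp_all
  moreover have "k + 1 < q" using q by simp
  ultimately show ?case using merge_result_root[OF q r, symmetric] by blast
next
  case (left l' l t)
  from left.IH[of "k + 1"] obtain i p q where
    pqr: "(p, q) \<in> mat l (k + 1)" "k + 1 + 1 < p" "(i, p - 1) \<in> mat l (k + 1)"
      "mat l' (k + 1) = merge_result (mat l (k + 1)) i p q" by blast
  from pqr(1,3) have "(p, q) \<in> mat (Node l t) k" "(i, p - 1) \<in> mat (Node l t) k" by simp_all
  moreover have "mat (Node l' t) k = merge_result (mat (Node l t) k) i p q"
    by (rule merge_result_left[OF pqr(1,3) rot_nodes[OF left.hyps, symmetric] pqr(4)])
  moreover have "k + 1 < p" using pqr(2) by simp
  ultimately show ?case by blast
next
  case (right t' t l)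
  let ?k = "k + 2 * nodes l + 2"
  from right.IH[of ?k] obtain i p q where
    pqr: "(p, q) \<in> mat t ?k" "?k + 1 < p" "(i, p - 1) \<in> mat t ?k"
      "mat t' ?k = merge_result (mat t ?k) i p q" by blast
  from pqr(1,3) have "(p, q) \<in> mat (Node l t) k" "(i, p - 1) \<in> mat (Node l t) k" by simp_all
  moreover have "mat (Node l t') k = merge_result (mat (Node l t) k) i p q"
    by (rule merge_result_right[OF pqr(1,3,4)])
  moreover have "k + 1 < p" using pqr(2) by simp
  ultimately show ?case by blast
qed

text \<open>If the arc at \<open>p - 1\<close> is the root arc, then \<open>(p, q)\<close> is the
  first arc below it and the root is rotated; otherwise both arcs lie in the same subtree.
  Positivity of \<open>p\<close> makes \<open>p - 1\<close> a true predecessor.\<close>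

lemma split_imp_rot:
  assumes "(p, q) \<in> mat t k" "(p - 1, r) \<in> mat t k" "0 < p"
  shows "\<exists>t'. rot t t' \<and> mat t' k = split_result (mat t k) p q r"
  using assms(1,2)
proof (induction t arbitrary: k)
  case Leaf
  then show ?case by simp
next
  case (Node l t)
  let ?m = "k + 2 * nodes l + 2"
  have pr: "p \<le> r" using mat_range[OF Node.prems(2)] by auto
  from Node.prems(2) consider "p - 1 = k" "r = k + 2 * nodes l + 1"
    | "(p - 1, r) \<in> mat l (k + 1)" | "(p - 1, r) \<in> mat t ?m" by auto
  then show ?case
  proof cases
    case 1
    then have p: "p = k + 1" using assms(3) by simp
    have "(p, q) \<notin> mat t ?m" using mat_range[of p q t ?m] p by auto
    then have l: "(p, q) \<in> mat l (k + 1)" using Node.prems(1) p by auto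
    then obtain a b where ab: "l = Node a b" by (cases l) auto
    \<comment> \<open>This is the root arc of the left subtree; it shares its start with
      \<open>(p, q)\<close>, so the two coincide and \<open>q\<close> is known.\<close>
    have "(k + 1, k + 1 + 2 * nodes a + 1) \<in> mat l (k + 1)" unfolding ab by simp
    from mat_unique[OF l this] have q: "q = k + 2 * nodes a + 2" using p by simp
    have r: "r = q + 2 * nodes b + 1" using 1(2) q ab by simp
    have "mat (Node a (Node b t)) k = split_result (mat (Node l t) k) p q r"
      unfolding ab p by (rule split_result_root[OF q r, symmetric])
    then show ?thesis unfolding ab by (blast intro: rot.root)
  next
    case 2
    then have "p \<noteq> k" "p < ?m" using mat_range[OF 2] assms(3) by auto
    then have l: "(p, q) \<in> mat l (k + 1)" using Node.prems(1) mat_range[of p q t ?m] by auto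
    obtain l' where "rot l l'" "mat l' (k + 1) = split_result (mat l (k + 1)) p q r"
      using Node.IH(1)[OF l 2] by blast
    then show ?thesis using split_result_left[OF l 2 rot_nodes] rot.left by blast
  next
    case 3
    then have "?m < p" using mat_range[OF 3] assms(3) by auto
    then have l: "(p, q) \<in> mat t ?m" using Node.prems(1) mat_range[of p q l "k + 1"] by auto
    obtain t' where "rot t t'" "mat t' ?m = split_result (mat t ?m) p q r"
      using Node.IH(2)[OF l 3] by blast
    then show ?thesis using split_result_right[OF l 3] rot.right by blast
  qed
qed

text \<open>The arc \<open>(p, q)\<close> is not the root arc, because an arc ends just before it.
  In the left subtree its predecessor lies there too; in the right one the predecessor is the root
  arc, which gives a rotation at the root, or lies in the right subtree.\<close>

lemma merge_imp_rot:
  assumes "(p, q) \<in> mat t k" "(i, p - 1) \<in> mat t k"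
  shows "\<exists>t'. rot t' t \<and> mat t' k = merge_result (mat t k) i p q"
  using assms
proof (induction t arbitrary: k)
  case Leaf
  then show ?case by simp
next
  case (Node l t)
  let ?m = "k + 2 * nodes l + 2"
  have ip: "k \<le> i" "i < p - 1" using mat_range[OF Node.prems(2)] by auto
  from Node.prems(1) ip consider "(p, q) \<in> mat l (k + 1)" | "(p, q) \<in> mat t ?m" by auto
  then show ?case
  proof cases
    case 1
    then have "p - 1 < k + 2 * nodes l + 1" using mat_range[OF 1] by auto
    then have l: "(i, p - 1) \<in> mat l (k + 1)"
      using Node.prems(2) mat_range[of i "p - 1" t ?m] by auto
    obtain l' where l': "rot l' l" "mat l' (k + 1) = merge_result (mat l (k + 1)) i p q"
      using Node.IH(1)[OF 1 l] by blast
    have "mat (Node l' t) k = merge_result (mat (Node l t) k) i p q"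
      by (rule merge_result_left[OF 1 l rot_nodes[OF l'(1), symmetric] l'(2)])
    then show ?thesis using rot.left[OF l'(1)] by blast
  next
    case 2
    then have m: "?m \<le> p" using mat_range[OF 2] by auto
    then have "(i, p - 1) \<notin> mat l (k + 1)" using mat_range[of i "p - 1" l "k + 1"] by auto
    then consider "i = k" "p - 1 = k + 2 * nodes l + 1" | "(i, p - 1) \<in> mat t ?m"
      using Node.prems(2) by auto
    then show ?thesis
    proof cases
      case i: 1
      \<comment> \<open>The root arc ends just before the right subtree, so \<open>(p, q)\<close> is
        the first arc of that subtree.\<close>
      then have p: "p = ?m" using m by simp
      obtain b c where t: "t = Node b c" using 2 by (cases t) auto
      have "(?m, ?m + 2 * nodes b + 1) \<in> mat t ?m" unfolding t by simp
      from mat_unique[OF 2 this] have q: "q = p + 2 * nodes b + 1" using p by simp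
      have "mat (Node (Node l b) c) k = merge_result (mat (Node l t) k) i p q"
        unfolding t i(1) by (rule merge_result_root[OF p q, symmetric])
      then show ?thesis unfolding t by (blast intro: rot.root)
    next
      case i: 2
      obtain t' where "rot t' t" "mat t' ?m = merge_result (mat t ?m) i p q"
        using Node.IH(2)[OF 2 i] by blast
      then show ?thesis using merge_result_right[OF 2 i] rot.right by blast
    qed
  qed
qed

lemma merge_or_split_mat_iff:
  "(\<exists>p q. (p, q) \<in> mat t 1 \<and> p > 1 \<and> (merge_for (mat t 1) (p, q) M' \<or> split_of (mat t 1) (p, q) M'))
     \<longleftrightarrow> (\<exists>t'. (rot t t' \<or> rot t' t) \<and> M' = mat t' 1)" (is "?L \<longleftrightarrow> ?R")
proof
  assume ?L
  then obtain p q where pq: "(p, q) \<in> mat t 1" "p > 1"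
    and "merge_for (mat t 1) (p, q) M' \<or> split_of (mat t 1) (p, q) M'" by blast
  from this(3) show ?R
  proof
    assume "merge_for (mat t 1) (p, q) M'"
    then obtain i where "(i, p - 1) \<in> mat t 1" "M' = merge_result (mat t 1) i p q"
      unfolding merge_for_def merge_result_def by blast
    then show ?R using merge_imp_rot[OF pq(1)] by blast
  next
    assume "split_of (mat t 1) (p, q) M'"
    then obtain r where "(p - 1, r) \<in> mat t 1" "M' = split_result (mat t 1) p q r"
      unfolding split_of_def split_result_def by blast
    then show ?R using split_imp_rot[OF pq(1)] pq(2) by fastforce
  qed
next
  assume ?R
  then obtain t' where "rot t t' \<or> rot t' t" and M': "M' = mat t' 1" by blast
  from this(1) show ?L
  proof
    assume "rot t t'"
    from rot_imp_split[OF this, of 1] obtain p q r where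
      "(p, q) \<in> mat t 1" "1 < p" "(p - 1, r) \<in> mat t 1" "M' = split_result (mat t 1) p q r"
      unfolding M' by blast
    then show ?L unfolding split_of_def split_result_def by blast
  next
    assume "rot t' t"
    from rot_imp_merge[OF this, of 1] obtain i p q where
      ipq: "(p, q) \<in> mat t 1" "1 + 1 < p" "(i, p - 1) \<in> mat t 1" "M' = merge_result (mat t 1) i p q"
      unfolding M' by blast
    then have "1 < p" "2 < p" by auto
    with ipq show ?L unfolding merge_for_def merge_result_def by blast
  qed
qed

theorem corollary10:
  fixes n :: nat
  assumes "n \<ge> 1"
  shows "(\<forall>T T'. triangulation (n + 2) T \<and> diagonal_flip T T' \<longrightarrow>
            (\<exists>p q. (p, q) \<in> matching_of n T \<and> p > 1 \<and>
               (merge_for (matching_of n T) (p, q) (matching_of n T') \<or>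
                split_of (matching_of n T) (p, q) (matching_of n T')))) \<and>
         (\<forall>M M' p q. plane_perfect_matching n M \<and> (p, q) \<in> M \<and> p > 1 \<and>
            (merge_for M (p, q) M' \<or> split_of M (p, q) M') \<longrightarrow>
            diagonal_flip (triangulation_of n M) (triangulation_of n M'))"
proof (intro conjI allI impI)
  fix T T' assume T: "triangulation (n + 2) T \<and> diagonal_flip T T'"
  then obtain t where t: "nodes t = n" "T = tri t 1"
    unfolding triangulation_iff_tri by blast
  then obtain t' where t': "rot t t' \<or> rot t' t" "T' = tri t' 1"
    using T diagonal_flip_tri_iff by blast
  \<comment> \<open>Rotations preserve the number of nodes, so \<open>T'\<close> again triangulates
    the same polygon and \<open>matching_of\<close> applies to it.\<close>
  have "nodes t' = n" using t' t rot_nodes by metis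
  then have "matching_of n T = mat t 1" "matching_of n T' = mat t' 1"
    using matching_of_tri t t'(2) by blast+
  then show "\<exists>p q. (p, q) \<in> matching_of n T \<and> p > 1 \<and>
      (merge_for (matching_of n T) (p, q) (matching_of n T') \<or>
       split_of (matching_of n T) (p, q) (matching_of n T'))"
    using merge_or_split_mat_iff[of t "mat t' 1"] t'(1) by auto
next
  fix M M' p q
  assume M: "plane_perfect_matching n M \<and> (p, q) \<in> M \<and> p > 1 \<and>
    (merge_for M (p, q) M' \<or> split_of M (p, q) M')"
  then obtain t where t: "nodes t = n" "M = mat t 1"
    unfolding plane_perfect_matching_iff_mat by blast
  then obtain t' where t': "rot t t' \<or> rot t' t" "M' = mat t' 1"
    using M merge_or_split_mat_iff[of t M'] by blast
  have "nodes t' = n" using t' t rot_nodes by metis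
  then have "triangulation_of n M = tri t 1" "triangulation_of n M' = tri t' 1"
    using triangulation_of_mat t t'(2) by blast+
  then show "diagonal_flip (triangulation_of n M) (triangulation_of n M')"
    using diagonal_flip_tri_iff t'(1) by auto
qed

end
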